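(* Let $G$ be a finite simple graph such that every induced subgraph $H$ of $G$ satisfies $|E(H)| \le 2|V(H)| - 1$. Then $a'(G) \le \Delta(G) + 3$, where $\Delta(G)$ is the maximum degree of $G$.
   Context: An acyclic edge coloring of a graph is a proper edge coloring (adjacent edges receive distinct colors) in which there is no bichromatic cycle, i.e. no cycle whose edges use only two colors. The acyclic chromatic index $a'(G)$ is the minimum number of colors in an acyclic edge coloring of $G$. *)

theory Defs
  imports Main
begin

definition simple_graph :: "'a set \<Rightarrow> 'a set set \<Rightarrow> bool" where
  "simple_graph V E \<longleftrightarrow> finite V \<and> (\<forall>e\<in>E. \<exists>u v. u \<in> V \<and> v \<in> V \<and> u \<noteq> v \<and> e = {u, v})"

definition degree :: "'a set set \<Rightarrow> 'a \<Rightarrow> nat" where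
  "degree E v = card {e \<in> E. v \<in> e}"

definition max_degree :: "'a set \<Rightarrow> 'a set set \<Rightarrow> nat" where
  "max_degree V E = (if V = {} then 0 else Max (degree E ` V))"

definition induced_edges :: "'a set set \<Rightarrow> 'a set \<Rightarrow> 'a set set" where
  "induced_edges E S = {e \<in> E. e \<subseteq> S}"

definition is_cycle :: "'a set set \<Rightarrow> 'a list \<Rightarrow> bool" where
  "is_cycle E vs \<longleftrightarrow> length vs \<ge> 3 \<and> distinct vs \<and>
     (\<forall>i < length vs. {vs ! i, vs ! (Suc i mod length vs)} \<in> E)"

definition cycle_edges :: "'a list \<Rightarrow> 'a set set" where
  "cycle_edges vs = {{vs ! i, vs ! (Suc i mod length vs)} | i. i < length vs}"

definition proper_edge_coloring :: "'a set set \<Rightarrow> nat \<Rightarrow> ('a set \<Rightarrow> nat) \<Rightarrow> bool" where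
  "proper_edge_coloring E k c \<longleftrightarrow> (\<forall>e\<in>E. c e < k) \<and>
     (\<forall>e\<in>E. \<forall>f\<in>E. e \<noteq> f \<and> e \<inter> f \<noteq> {} \<longrightarrow> c e \<noteq> c f)"

definition acyclic_edge_coloring :: "'a set set \<Rightarrow> nat \<Rightarrow> ('a set \<Rightarrow> nat) \<Rightarrow> bool" where
  "acyclic_edge_coloring E k c \<longleftrightarrow> proper_edge_coloring E k c \<and>
     (\<forall>vs. is_cycle E vs \<longrightarrow> card (c ` cycle_edges vs) > 2)"

definition acyclic_chromatic_index :: "'a set \<Rightarrow> 'a set set \<Rightarrow> nat" where
  "acyclic_chromatic_index V E = (LEAST k. \<exists>c. acyclic_edge_coloring E k c)"

end

(* The edges at a vertex u can be coloured once the rest of the graph is, provided the new edges get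
   distinct colours that are absent at their other ends and no two of those ends are joined by a path
   alternating between the two colours in question. Components of a bichromatic subgraph are paths,
   so three vertices each missing one of the two colours never lie in a common component; this is
   what makes the recolouring arguments work.

   With Delta + 3 colours a smallest counterexample has no vertex of degree 1, no 2-vertex with a
   neighbour that has at most three neighbours of degree at least 5, no 3-vertex with a neighbour of
   degree at most 4, and no 5-vertex with four neighbours of degree 3. Discharging then gives
   |E| >= 2 |V|, contrary to the sparsity of the graph. *)
theory Submission
  imports Defs
begin

text \<open>The obstacle is the last edge \<open>uv\<close> at a 3-vertex \<open>u\<close>, and
  failure to colour it carries information. If \<open>ua\<close> and \<open>ub\<close> are coloured
  and nothing fits \<open>uv\<close>, every other colour missing at \<open>v\<close> is blocked by
  an alternating path, hence is seen at \<open>a\<close> or \<open>b\<close>. These see at most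
  \<Delta> - 1 colours once \<open>u\<close> is removed, so with \<Delta> + 3 colours the count is
  tight: it determines the colour sets around \<open>u\<close> and \<open>v\<close>, and this
  rigidity is what allows a recolouring that breaks a blocking path. Minimality is taken over edge
  sets with the number of colours fixed, so that deleting only \<open>uv\<close> already yields
  compatible colours for \<open>ua\<close> and \<open>ub\<close>. The target |E| \<ge> 2 |V| means
  average degree at least 4, whence the charge 3 (deg - 4); the factor 3 makes the transferred
  amounts integral.\<close>

definition seen :: "'a set set \<Rightarrow> ('a set \<Rightarrow> nat) \<Rightarrow> 'a \<Rightarrow> nat set" where
  "seen E c x = c ` {e \<in> E. x \<in> e}"

definition bichromatic :: "'a set set \<Rightarrow> ('a set \<Rightarrow> nat) \<Rightarrow> nat \<Rightarrow> nat \<Rightarrow> ('a \<times> 'a) set" where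
  "bichromatic E c p q = {(x, y). {x, y} \<in> E \<and> (c {x, y} = p \<or> c {x, y} = q)}"

text \<open>Every bichromatic subgraph is a forest: the ends of an edge are not connected without it. This
  avoids cycles as lists; loops are excluded because the closure is reflexive.\<close>

definition acyclic_coloring :: "'a set set \<Rightarrow> nat \<Rightarrow> ('a set \<Rightarrow> nat) \<Rightarrow> bool" where
  "acyclic_coloring E k c \<longleftrightarrow> proper_edge_coloring E k c \<and>
     (\<forall>x y q. {x, y} \<in> E \<longrightarrow> (x, y) \<notin> (bichromatic (E - {{x, y}}) c (c {x, y}) q)\<^sup>*)"

definition graph_edges :: "'a set set \<Rightarrow> bool" where
  "graph_edges E \<longleftrightarrow> finite E \<and> (\<forall>e\<in>E. \<exists>x y. x \<noteq> y \<and> e = {x, y})"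

lemma sym_bichromatic: "sym (bichromatic E c p q)"
  by (auto simp: bichromatic_def sym_def insert_commute)

lemma bichromatic_rev: "(x, y) \<in> (bichromatic E c p q)\<^sup>* \<Longrightarrow> (y, x) \<in> (bichromatic E c p q)\<^sup>*"
  by (meson sym_bichromatic sym_rtrancl symD)

lemma bichromatic_commute: "bichromatic E c p q = bichromatic E c q p"
  by (auto simp: bichromatic_def)

lemma bichromatic_mono: "E \<subseteq> E' \<Longrightarrow> bichromatic E c p q \<subseteq> bichromatic E' c p q"
  by (auto simp: bichromatic_def)

lemma bichromatic_cong: "(\<And>e. e \<in> E \<Longrightarrow> c e = c' e) \<Longrightarrow> bichromatic E c p q = bichromatic E c' p q"
  by (auto simp: bichromatic_def)

lemma seen_mono: "E \<subseteq> E' \<Longrightarrow> seen E c x \<subseteq> seen E' c x"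
  by (auto simp: seen_def)

lemma seenI: "{x, y} \<in> E \<Longrightarrow> c {x, y} \<in> seen E c x"
  by (auto simp: seen_def)

lemma seenI': "{x, y} \<in> E \<Longrightarrow> c {x, y} \<in> seen E c y"
  by (auto simp: seen_def)

lemma finite_seen: "graph_edges E \<Longrightarrow> finite (seen E c x)"
  by (auto simp: seen_def graph_edges_def)

lemma card_seen: "graph_edges E \<Longrightarrow> card (seen E c x) \<le> degree E x"
  by (auto simp: seen_def graph_edges_def degree_def intro: card_image_le)

lemma seenE:
  assumes "graph_edges E" "q \<in> seen E c x"
  obtains y where "{x, y} \<in> E" "c {x, y} = q" "y \<noteq> x"
proof -
  obtain e where e: "e \<in> E" "x \<in> e" "c e = q" using assms(2) by (auto simp: seen_def)
  obtain a b where ab: "e = {a, b}" "a \<noteq> b" using e assms(1) unfolding graph_edges_def by blast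
  then have "e = {x, if x = a then b else a}" "(if x = a then b else a) \<noteq> x" using e by auto
  then show thesis using that e by metis
qed

lemma seen_insert:
  "{u, v} \<notin> E \<Longrightarrow> seen (insert {u, v} E) (c({u, v} := r)) x =
     (if x = u \<or> x = v then insert r (seen E c x) else seen E c x)"
  by (auto simp: seen_def image_iff)

lemma finite_bichromatic:
  assumes "graph_edges E"
  shows "finite (bichromatic E c p q)"
proof -
  have "finite (\<Union>E)" using assms by (auto simp: graph_edges_def)
  moreover have "bichromatic E c p q \<subseteq> \<Union>E \<times> \<Union>E" by (auto simp: bichromatic_def)
  ultimately show ?thesis by (meson finite_SigmaI finite_subset)
qed

lemma graph_edges_subset: "graph_edges E \<Longrightarrow> E' \<subseteq> E \<Longrightarrow> graph_edges E'"
  unfolding graph_edges_def by (meson finite_subset subsetD)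

lemma graph_edges_insert: "graph_edges E \<Longrightarrow> u \<noteq> v \<Longrightarrow> graph_edges (insert {u, v} E)"
  unfolding graph_edges_def by blast

lemma acyclic_coloringD_less: "acyclic_coloring E k c \<Longrightarrow> e \<in> E \<Longrightarrow> c e < k"
  by (auto simp: acyclic_coloring_def proper_edge_coloring_def)

lemma seen_less: "acyclic_coloring E k c \<Longrightarrow> q \<in> seen E c x \<Longrightarrow> q < k"
  by (auto simp: seen_def acyclic_coloringD_less)

lemma acyclic_coloringD_unlinked: "acyclic_coloring E k c \<Longrightarrow> {x, y} \<in> E \<Longrightarrow> (x, y) \<notin> (bichromatic (E - {{x, y}}) c (c {x, y}) q)\<^sup>*"
  by (simp add: acyclic_coloring_def)

lemma acyclic_coloring_unique:
  assumes "acyclic_coloring E k c" "{x, y} \<in> E" "{x, z} \<in> E" "c {x, y} = c {x, z}"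
  shows "y = z"
proof -
  have "{x, y} = {x, z}"
    using assms unfolding acyclic_coloring_def proper_edge_coloring_def by (metis disjoint_insert(1) insertI1)
  then show ?thesis by (auto simp: doubleton_eq_iff)
qed

lemma acyclic_coloring_subset:
  assumes "acyclic_coloring E k c" "E' \<subseteq> E"
  shows "acyclic_coloring E' k c"
proof -
  have "(x, y) \<notin> (bichromatic (E' - {{x, y}}) c (c {x, y}) q)\<^sup>*" if "{x, y} \<in> E'" for x y q
  proof -
    have "bichromatic (E' - {{x, y}}) c (c {x, y}) q \<subseteq> bichromatic (E - {{x, y}}) c (c {x, y}) q"
      using assms(2) by (intro bichromatic_mono) auto
    then show ?thesis using assms that unfolding acyclic_coloring_def by (meson rtrancl_mono subsetD)
  qed
  then show ?thesis using assms unfolding acyclic_coloring_def proper_edge_coloring_def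
    by (meson subsetD)
qed

section \<open>Extending an acyclic colouring by one edge\<close>

lemma rtrancl_add_edge:
  assumes "(x, y) \<in> (R \<union> {(u, v), (v, u)})\<^sup>*"
  shows "(x, y) \<in> R\<^sup>* \<or> ((x, u) \<in> R\<^sup>* \<and> (v, y) \<in> R\<^sup>*) \<or> ((x, v) \<in> R\<^sup>* \<and> (u, y) \<in> R\<^sup>*)"
  using assms
proof (induction rule: rtrancl_induct)
  case (step y z)
  then show ?case by (auto intro: rtrancl.rtrancl_into_rtrancl)
qed auto

text \<open>A two-coloured cycle through the new edge, seen from any other edge \<open>xy\<close> on
  it, is a path from \<open>x\<close> to \<open>y\<close> through \<open>uv\<close>. Splitting it at
  \<open>uv\<close> and closing it with \<open>xy\<close> links \<open>u\<close> to \<open>v\<close>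
  without the new edge, so the single condition \<open>nl\<close> takes care of all edges.\<close>

lemma acyclic_coloring_insert:
  assumes g: "acyclic_coloring E k c" and uv: "u \<noteq> v" "{u, v} \<notin> E" and r: "r < k"
    "r \<notin> seen E c u" "r \<notin> seen E c v"
    and nl: "\<And>q. (u, v) \<notin> (bichromatic E c r q)\<^sup>*"
  shows "acyclic_coloring (insert {u, v} E) k (c({u, v} := r))"
proof -
  let ?c = "c({u, v} := r)"
  have agree: "\<And>e. e \<in> E \<Longrightarrow> ?c e = c e" using uv by auto
  have nc: "c f \<noteq> r" if "f \<in> E" "{u, v} \<inter> f \<noteq> {}" for f
    using that r by (auto simp: seen_def)
  have "proper_edge_coloring (insert {u, v} E) k ?c"
    unfolding proper_edge_coloring_def
  proof (intro conjI ballI impI)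
    fix e assume "e \<in> insert {u, v} E"
    then show "?c e < k" using r acyclic_coloringD_less[OF g] by auto
  next
    fix e f assume ef: "e \<in> insert {u, v} E" "f \<in> insert {u, v} E" "e \<noteq> f \<and> e \<inter> f \<noteq> {}"
    consider "e = {u, v}" "f \<in> E" | "f = {u, v}" "e \<in> E" | "e \<in> E" "f \<in> E" using ef by blast
    then show "?c e \<noteq> ?c f"
    proof cases
      case 1 then show ?thesis using nc[of f] ef uv(2) by auto
    next
      case 2 then show ?thesis using nc[of e] ef uv(2) by (auto simp: Int_commute)
    next
      case 3 then show ?thesis using g ef agree unfolding acyclic_coloring_def proper_edge_coloring_def by metis
    qed
  qed
  moreover have "(x, y) \<notin> (bichromatic (insert {u, v} E - {{x, y}}) ?c (?c {x, y}) q)\<^sup>*"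
    if xy: "{x, y} \<in> insert {u, v} E" for x y q
  proof (cases "{x, y} = {u, v}")
    case True
    have "insert {u, v} E - {{x, y}} = E" using True uv by auto
    moreover have "bichromatic E ?c r q = bichromatic E c r q" using agree by (rule bichromatic_cong)
    moreover have "(x = u \<and> y = v) \<or> (x = v \<and> y = u)" using True by (auto simp: doubleton_eq_iff)
    ultimately show ?thesis using nl[of q] bichromatic_rev True by (metis fun_upd_same)
  next
    case False
    then have xE: "{x, y} \<in> E" using xy by auto
    let ?R = "bichromatic (E - {{x, y}}) c (c {x, y}) q"
    have cxy: "?c {x, y} = c {x, y}" using False by auto
    have nR: "(x, y) \<notin> ?R\<^sup>*" using acyclic_coloringD_unlinked[OF g xE] .
    show ?thesis
    proof
      assume a: "(x, y) \<in> (bichromatic (insert {u, v} E - {{x, y}}) ?c (?c {x, y}) q)\<^sup>*"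
      \<comment> \<open>If \<open>r\<close> is neither of the two colours, the path avoids the new
        edge and already contradicts the acyclicity of \<open>c\<close>.\<close>
      have rr: "r = c {x, y} \<or> r = q"
      proof (rule ccontr)
        assume "\<not> ?thesis"
        then have "bichromatic (insert {u, v} E - {{x, y}}) ?c (?c {x, y}) q \<subseteq> ?R"
          unfolding bichromatic_def cxy using uv by (auto split: if_splits)
        then show False using a nR rtrancl_mono by blast
      qed
      have "bichromatic (insert {u, v} E - {{x, y}}) ?c (?c {x, y}) q \<subseteq> ?R \<union> {(u, v), (v, u)}"
        unfolding bichromatic_def cxy using uv by (auto simp: doubleton_eq_iff split: if_splits)
      then have "(x, y) \<in> (?R \<union> {(u, v), (v, u)})\<^sup>*" using a rtrancl_mono by blast
      then have d: "((x, u) \<in> ?R\<^sup>* \<and> (v, y) \<in> ?R\<^sup>*) \<or> ((x, v) \<in> ?R\<^sup>* \<and> (u, y) \<in> ?R\<^sup>*)"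
        using rtrancl_add_edge nR by metis
      let ?S = "bichromatic E c (c {x, y}) q"
      have sub: "?R\<^sup>* \<subseteq> ?S\<^sup>*" by (intro rtrancl_mono bichromatic_mono) auto
      have xyS: "(x, y) \<in> ?S\<^sup>*" using xE by (auto simp: bichromatic_def)
      have "(u, v) \<in> ?S\<^sup>*" using d
      proof
        assume "(x, u) \<in> ?R\<^sup>* \<and> (v, y) \<in> ?R\<^sup>*"
        then have "(u, x) \<in> ?S\<^sup>*" "(y, v) \<in> ?S\<^sup>*" using sub bichromatic_rev by (metis subsetD)+
        then show ?thesis using xyS by (meson rtrancl_trans)
      next
        assume "(x, v) \<in> ?R\<^sup>* \<and> (u, y) \<in> ?R\<^sup>*"
        then have "(x, v) \<in> ?S\<^sup>*" "(u, y) \<in> ?S\<^sup>*" using sub by auto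
        then show ?thesis using bichromatic_rev[OF xyS] by (meson rtrancl_trans)
      qed
      then show False using nl rr bichromatic_commute by metis
    qed
  qed
  ultimately show ?thesis unfolding acyclic_coloring_def by blast
qed

text \<open>Removing the closing edge of a cycle in at most two colours leaves a path between the
  ends of that edge, which a forest excludes.\<close>

lemma forest_imp_acyclic_edge_coloring:
  assumes g: "acyclic_coloring E k c"
  shows "acyclic_edge_coloring E k c"
proof -
  have "card (c ` cycle_edges vs) > 2" if cyc: "is_cycle E vs" for vs
  proof (rule ccontr)
    assume "\<not> ?thesis"
    then have le: "card (c ` cycle_edges vs) \<le> 2" by simp
    let ?n = "length vs"
    have n: "?n \<ge> 3" "distinct vs"
      and E: "\<And>i. i < ?n \<Longrightarrow> {vs ! i, vs ! (Suc i mod ?n)} \<in> E"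
      using cyc by (auto simp: is_cycle_def)
    have fin: "finite (cycle_edges vs)" unfolding cycle_edges_def by auto
    let ?x = "vs ! 0" and ?y = "vs ! (?n - 1)"
    have sm: "Suc (?n - 1) mod ?n = 0" using n(1) by (cases ?n) auto
    have last: "{?x, ?y} \<in> E" "c {?x, ?y} \<in> c ` cycle_edges vs"
    proof -
      show "{?x, ?y} \<in> E" using E[of "?n - 1"] n sm by (simp add: insert_commute)
      have "{?y, ?x} \<in> cycle_edges vs" unfolding cycle_edges_def
        using sm n by (intro CollectI exI[of _ "?n - 1"]) auto
      then show "c {?x, ?y} \<in> c ` cycle_edges vs" by (auto simp: insert_commute)
    qed
    define p where "p = c {?x, ?y}"
    have "card (c ` cycle_edges vs - {p}) \<le> 1"
      using le last fin unfolding p_def by (subst card_Diff_singleton) auto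
    then obtain q where q: "c ` cycle_edges vs - {p} \<subseteq> {q}"
      using fin by (metis (no_types, lifting) One_nat_def card_le_Suc0_iff_eq finite_Diff finite_imageI subsetI singleton_iff)
    have "i \<le> ?n - 1 \<Longrightarrow> (?x, vs ! i) \<in> (bichromatic (E - {{?x, ?y}}) c p q)\<^sup>*" for i
    proof (induction i)
      case (Suc i)
      have i: "Suc i < ?n" "i < ?n" using Suc n by auto
      have s: "Suc i mod ?n = Suc i" using i by simp
      have "{vs ! i, vs ! Suc i} \<in> E" using E[of i] i s by simp
      \<comment> \<open>Length at least 3 enters here: on two vertices the path would consist of the
        closing edge itself.\<close>
      moreover have "{vs ! i, vs ! Suc i} \<noteq> {?x, ?y}"
      proof
        assume "{vs ! i, vs ! Suc i} = {?x, ?y}"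
        then have "(vs ! i = ?x \<and> vs ! Suc i = ?y) \<or> (vs ! Suc i = ?x)"
          by (auto simp: doubleton_eq_iff)
        moreover have "vs ! Suc i \<noteq> ?x" using nth_eq_iff_index_eq[OF n(2), of "Suc i" 0] i by force
        moreover have "i = 0" if "vs ! i = ?x" using nth_eq_iff_index_eq[OF n(2), of i 0] i that by force
        moreover have "Suc i = ?n - 1" if "vs ! Suc i = ?y"
          using nth_eq_iff_index_eq[OF n(2), of "Suc i" "?n - 1"] i that by force
        ultimately show False using n by auto
      qed
      moreover have "c {vs ! i, vs ! Suc i} \<in> c ` cycle_edges vs"
      proof -
        have "{vs ! i, vs ! Suc i} \<in> cycle_edges vs" unfolding cycle_edges_def
          using i s by (intro CollectI exI[of _ i]) auto
        then show ?thesis by blast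
      qed
      then have "c {vs ! i, vs ! Suc i} = p \<or> c {vs ! i, vs ! Suc i} = q" using q by auto
      ultimately have "(vs ! i, vs ! Suc i) \<in> bichromatic (E - {{?x, ?y}}) c p q"
        by (auto simp: bichromatic_def)
      moreover have "(?x, vs ! i) \<in> (bichromatic (E - {{?x, ?y}}) c p q)\<^sup>*" using Suc by simp
      ultimately show ?case by (rule rtrancl.rtrancl_into_rtrancl[rotated])
    qed simp
    then have "(?x, ?y) \<in> (bichromatic (E - {{?x, ?y}}) c p q)\<^sup>*" by simp
    then show False using acyclic_coloringD_unlinked[OF g last(1)] unfolding p_def by blast
  qed
  then show ?thesis using g unfolding acyclic_edge_coloring_def acyclic_coloring_def by blast
qed

section \<open>Bichromatic components as paths\<close>

text \<open>After its last visit to \<open>u\<close> a walk continues from \<open>w\<close> and no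
  longer touches \<open>u\<close>, so it uses the edge \<open>uw\<close> in neither
  direction.\<close>

lemma rtrancl_leaf:
  assumes "(u, y) \<in> R\<^sup>*" "\<And>z. (u, z) \<in> R \<Longrightarrow> z = w"
  shows "y = u \<or> (w, y) \<in> (R - {(u, w), (w, u)})\<^sup>*"
  using assms(1)
proof (induction rule: rtrancl_induct)
  case (step y z)
  show ?case
  proof (cases "y = u")
    case True
    then show ?thesis using step assms(2) by auto
  next
    case False
    then have *: "(w, y) \<in> (R - {(u, w), (w, u)})\<^sup>*" using step by auto
    show ?thesis
    proof (cases "z = u")
      case False
      then have "(y, z) \<in> R - {(u, w), (w, u)}" using step \<open>y \<noteq> u\<close> by auto
      then show ?thesis using * by (meson rtrancl.rtrancl_into_rtrancl)
    qed simp
  qed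
qed simp

text \<open>The component is peeled from its end: without the edge from \<open>u\<close> to
  \<open>u'\<close>, the vertex \<open>u'\<close> has at most one neighbour left and takes the role
  of \<open>u\<close>. It differs from \<open>v\<close> and \<open>w\<close>, since either of these
  would now be isolated and yet linked to the other.\<close>

lemma three_ends:
  assumes "finite R" "sym R"
    and "\<And>x y z w. (x, y) \<in> R \<Longrightarrow> (x, z) \<in> R \<Longrightarrow> (x, w) \<in> R \<Longrightarrow> y = z \<or> y = w \<or> z = w"
    and "\<And>y z. (u, y) \<in> R \<Longrightarrow> (u, z) \<in> R \<Longrightarrow> y = z"
    and "\<And>y z. (v, y) \<in> R \<Longrightarrow> (v, z) \<in> R \<Longrightarrow> y = z"
    and "\<And>y z. (w, y) \<in> R \<Longrightarrow> (w, z) \<in> R \<Longrightarrow> y = z"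
    and "u \<noteq> v" "u \<noteq> w" "v \<noteq> w"
    and "(u, v) \<in> R\<^sup>*" "(u, w) \<in> R\<^sup>*"
  shows False
  using assms
proof (induction R arbitrary: u rule: finite_psubset_induct)
  case (psubset R)
  note symR = psubset.prems(1) and deg = psubset.prems(2)
  obtain u' where u': "(u, u') \<in> R"
    using psubset.prems(9) psubset.prems(6) by (meson converse_rtranclE)
  let ?R = "R - {(u, u'), (u', u)}"
  have uu: "\<And>z. (u, z) \<in> R \<Longrightarrow> z = u'" using u' psubset.prems(3) by blast
  have v': "(u', v) \<in> ?R\<^sup>*" using rtrancl_leaf[OF psubset.prems(9) uu] psubset.prems(6) by auto
  have w': "(u', w) \<in> ?R\<^sup>*" using rtrancl_leaf[OF psubset.prems(10) uu] psubset.prems(7) by auto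
  have u'u: "(u', u) \<in> R" using u' symR by (auto dest: symD)
  have "u' \<noteq> v"
  proof
    assume e: "u' = v"
    then have "\<And>z. (v, z) \<notin> ?R" using psubset.prems(4) u'u by blast
    then show False using w' e psubset.prems(8) by (metis converse_rtranclE)
  qed
  moreover have "u' \<noteq> w"
  proof
    assume e: "u' = w"
    then have "\<And>z. (w, z) \<notin> ?R" using psubset.prems(5) u'u by blast
    then show False using v' e psubset.prems(8) by (metis converse_rtranclE)
  qed
  moreover have "?R \<subset> R" using u' by auto
  moreover have "sym ?R" using symR by (auto simp: sym_def)
  moreover have "\<And>y z. (u', y) \<in> ?R \<Longrightarrow> (u', z) \<in> ?R \<Longrightarrow> y = z"
    using deg[OF u'u] by blast
  moreover have "\<And>x y z w. (x, y) \<in> ?R \<Longrightarrow> (x, z) \<in> ?R \<Longrightarrow> (x, w) \<in> ?R \<Longrightarrow> y = z \<or> y = w \<or> z = w"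
    using deg by blast
  moreover have "\<And>y z. (v, y) \<in> ?R \<Longrightarrow> (v, z) \<in> ?R \<Longrightarrow> y = z"
    "\<And>y z. (w, y) \<in> ?R \<Longrightarrow> (w, z) \<in> ?R \<Longrightarrow> y = z"
    using psubset.prems(4,5) by blast+
  ultimately show False
    using psubset.IH[of ?R u'] psubset.prems(8) v' w' by blast
qed

lemma bichromatic_end:
  assumes "acyclic_coloring E k c" "p \<notin> seen E c x \<or> q \<notin> seen E c x"
    "(x, y) \<in> bichromatic E c p q" "(x, z) \<in> bichromatic E c p q"
  shows "y = z"
proof -
  have E: "{x, y} \<in> E" "{x, z} \<in> E" using assms(3,4) by (auto simp: bichromatic_def)
  then have "c {x, y} = c {x, z}" 
    using assms(2-4) seenI[OF E(1), of c] seenI[OF E(2), of c] unfolding bichromatic_def by auto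
  then show ?thesis using acyclic_coloring_unique[OF assms(1)] E by blast
qed

lemma acyclic_coloring_three_ends:
  assumes "graph_edges E" "acyclic_coloring E k c"
    and "p \<notin> seen E c x \<or> q \<notin> seen E c x"
    and "p \<notin> seen E c y \<or> q \<notin> seen E c y"
    and "p \<notin> seen E c z \<or> q \<notin> seen E c z"
    and "x \<noteq> y" "x \<noteq> z" "y \<noteq> z" "(x, y) \<in> (bichromatic E c p q)\<^sup>*" "(x, z) \<in> (bichromatic E c p q)\<^sup>*"
  shows False
proof (rule three_ends[where R = "bichromatic E c p q" and u = x and v = y and w = z])
  show "y = z \<or> y = w \<or> z = w"
    if "(x, y) \<in> bichromatic E c p q" "(x, z) \<in> bichromatic E c p q" "(x, w) \<in> bichromatic E c p q" for x y z w
  proof -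
    have "{x, y} \<in> E" "{x, z} \<in> E" "{x, w} \<in> E" using that by (auto simp: bichromatic_def)
    then show ?thesis using that acyclic_coloring_unique[OF assms(2)] unfolding bichromatic_def by fastforce
  qed
qed (use assms finite_bichromatic sym_bichromatic bichromatic_end[OF assms(2)] in blast)+

lemma linked_seen:
  assumes "(x, y) \<in> (bichromatic E c p q)\<^sup>*" "x \<noteq> y" "p \<notin> seen E c x"
  shows "q \<in> seen E c x"
proof -
  obtain w where "(x, w) \<in> bichromatic E c p q" using assms(1,2) by (meson converse_rtranclE)
  then show ?thesis using assms(3) by (auto simp: bichromatic_def dest: seenI[where c = c])
qed

text \<open>The path must start with the edge \<open>xw\<close>, as \<open>p\<close> is missing at
  \<open>x\<close>. It cannot stop at \<open>w\<close>, because \<open>y\<close> misses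
  \<open>q\<close>; so it leaves \<open>w\<close> along an edge of colour \<open>p\<close>.\<close>

lemma linked_seen_nb:
  assumes g: "acyclic_coloring E k c" and l: "(x, y) \<in> (bichromatic E c p q)\<^sup>*" and xy: "x \<noteq> y" and p: "p \<notin> seen E c x"
    and w: "{x, w} \<in> E" "c {x, w} = q" "q \<notin> seen E c y"
  shows "p \<in> seen E c w"
proof -
  have xw: "(x, w) \<in> bichromatic E c p q" using w by (auto simp: bichromatic_def)
  have wy: "w \<noteq> y" using w seenI' by metis
  have "(w, y) \<in> (bichromatic E c p q - {(x, w), (w, x)})\<^sup>*"
    using rtrancl_leaf[OF l, of w] xy bichromatic_end[OF g disjI1[OF p] _ xw] by blast
  then obtain t where t: "(w, t) \<in> bichromatic E c p q" "t \<noteq> x" using wy 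
    by (metis DiffD1 DiffD2 converse_rtranclE insertCI)
  then have wE: "{w, t} \<in> E" by (auto simp: bichromatic_def)
  have "c {w, t} \<noteq> q" using acyclic_coloring_unique[OF g wE, of x] w t by (auto simp: insert_commute)
  then show ?thesis using t seenI[OF wE, of c] by (auto simp: bichromatic_def)
qed

section \<open>Local criteria for colouring a new edge\<close>

text \<open>A path from \<open>v\<close> to \<open>u\<close> in colours \<open>r\<close> and
  \<open>q\<close> starts with colour \<open>q\<close>, which \<open>u\<close> must see as well, and
  goes on from the next vertex with colour \<open>r\<close>. Only neighbours of \<open>v\<close>
  along a colour common to \<open>u\<close> and \<open>v\<close> matter; for disjoint colour sets
  \<open>nb\<close> is vacuous.\<close>

lemma acyclic_coloring_insert_seen:
  assumes g: "acyclic_coloring E k c" and uv: "u \<noteq> v" "{u, v} \<notin> E" and r: "r < k"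
    "r \<notin> seen E c u" "r \<notin> seen E c v"
    and nb: "\<And>w. {v, w} \<in> E \<Longrightarrow> c {v, w} \<in> seen E c u \<Longrightarrow> r \<notin> seen E c w"
  shows "acyclic_coloring (insert {u, v} E) k (c({u, v} := r))"
proof (rule acyclic_coloring_insert[OF g uv r])
  fix q
  show "(u, v) \<notin> (bichromatic E c r q)\<^sup>*"
  proof
    assume l: "(u, v) \<in> (bichromatic E c r q)\<^sup>*"
    have q: "q \<in> seen E c u" using linked_seen[OF l uv(1) r(2)] .
    have l': "(v, u) \<in> (bichromatic E c r q)\<^sup>*" using bichromatic_rev[OF l] .
    obtain w where w: "(v, w) \<in> bichromatic E c r q" using l' uv by (metis converse_rtranclE)
    have wE: "{v, w} \<in> E" and cw: "c {v, w} = q"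
      using w r(3) by (auto simp: bichromatic_def dest: seenI[where c = c])
    have rw: "r \<notin> seen E c w" using nb wE cw q by auto
    have "w \<noteq> u" using wE uv by (auto simp: insert_commute)
    have "(w, u) \<in> (bichromatic E c r q - {(v, w), (w, v)})\<^sup>*"
      using rtrancl_leaf[OF l', of w] uv bichromatic_end[OF g disjI1[OF r(3)] _ w] by blast
    then obtain t where t: "(w, t) \<in> bichromatic E c r q" "t \<noteq> v" using \<open>w \<noteq> u\<close>
      by (metis DiffD1 DiffD2 converse_rtranclE insertCI)
    then have wt: "{w, t} \<in> E" by (auto simp: bichromatic_def)
    have "c {w, t} \<noteq> q" using acyclic_coloring_unique[OF g wt, of v] wE cw t by (auto simp: insert_commute)
    then show False using t rw seenI[OF wt, of c] by (auto simp: bichromatic_def)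
  qed
qed

text \<open>Since \<open>u\<close> misses \<open>r\<close>, a blocking path leaves \<open>u\<close>
  by its one edge of the second colour and never returns. The condition can thus be checked in the
  graph without \<open>u\<close>, which stays the same while the edges at \<open>u\<close> are added
  one by one.\<close>

lemma acyclic_coloring_insert_star:
  assumes g: "acyclic_coloring E k c" and uv: "u \<noteq> v" "{u, v} \<notin> E" and r: "r < k"
    "r \<notin> seen E c u" "r \<notin> seen E c v"
    and nb: "\<And>w. {u, w} \<in> E \<Longrightarrow> (w, v) \<notin> (bichromatic {e \<in> E. u \<notin> e} c r (c {u, w}))\<^sup>*"
  shows "acyclic_coloring (insert {u, v} E) k (c({u, v} := r))"
proof (rule acyclic_coloring_insert[OF g uv r])
  fix q
  show "(u, v) \<notin> (bichromatic E c r q)\<^sup>*"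
  proof
    assume l: "(u, v) \<in> (bichromatic E c r q)\<^sup>*"
    obtain w where w: "(u, w) \<in> bichromatic E c r q" using l uv by (metis converse_rtranclE)
    have wE: "{u, w} \<in> E" and cw: "c {u, w} = q"
      using w r(2) by (auto simp: bichromatic_def dest: seenI[where c = c])
    have un: "\<And>z. (u, z) \<in> bichromatic E c r q \<Longrightarrow> z = w" using bichromatic_end[OF g disjI1[OF r(2)] _ w] by blast
    have "(w, v) \<in> (bichromatic E c r q - {(u, w), (w, u)})\<^sup>*"
      using rtrancl_leaf[OF l un] uv by blast
    moreover have "bichromatic E c r q - {(u, w), (w, u)} \<subseteq> bichromatic {e \<in> E. u \<notin> e} c r q"
    proof
      fix t assume t: "t \<in> bichromatic E c r q - {(u, w), (w, u)}"
      obtain x y where xy: "t = (x, y)" by force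
      have "x \<noteq> u" using t un xy by auto
      moreover have "y \<noteq> u" using t un xy sym_bichromatic[of E c r q] by (auto dest: symD)
      ultimately show "t \<in> bichromatic {e \<in> E. u \<notin> e} c r q" using t xy by (auto simp: bichromatic_def)
    qed
    ultimately show False using nb[OF wE] cw by (metis rtrancl_mono subsetD)
  qed
qed

lemma unlinked:
  assumes "x \<noteq> y" "p \<notin> seen E c x" "q \<notin> seen E c x"
  shows "(x, y) \<notin> (bichromatic E c p q)\<^sup>*" "(y, x) \<notin> (bichromatic E c p q)\<^sup>*"
proof -
  show "(x, y) \<notin> (bichromatic E c p q)\<^sup>*" using linked_seen[of x y E c p q] assms by blast
  then show "(y, x) \<notin> (bichromatic E c p q)\<^sup>*" using bichromatic_rev by metis
qed

lemma seen_remove: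
  assumes g: "acyclic_coloring E k c" and xy: "{x, y} \<in> E"
  shows "seen (E - {{x, y}}) c w =
    (if w = x \<or> w = y then seen E c w - {c {x, y}} else seen E c w)"
proof -
  have "c e \<noteq> c {x, y}" if "e \<in> E" "e \<noteq> {x, y}" "x \<in> e \<or> y \<in> e" for e
    using g xy that unfolding acyclic_coloring_def proper_edge_coloring_def by (metis disjoint_iff insert_iff)
  then show ?thesis using xy by (auto simp: seen_def)
qed

lemma pick_color:
  fixes k :: nat
  assumes "card A < k" "finite A"
  obtains r where "r < k" "r \<notin> A"
proof -
  have "\<not> {..<k} \<subseteq> A" using assms card_mono[OF assms(2), of "{..<k}"] by auto
  then show thesis using that by blast
qed

section \<open>Colouring the edges at a vertex of degree 3\<close>

text \<open>Here \<open>E\<close> is the graph without the vertex \<open>u\<close>; the edges \<open>ua\<close> and \<open>ub\<close> may receive the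
  colours \<open>p\<close> and \<open>q\<close>.\<close>

definition fork :: "'a set set \<Rightarrow> nat \<Rightarrow> 'a \<Rightarrow> 'a \<Rightarrow> ('a set \<Rightarrow> nat) \<Rightarrow> nat \<Rightarrow> nat \<Rightarrow> bool" where
  "fork E k a b c p q \<longleftrightarrow> acyclic_coloring E k c \<and> p < k \<and> q < k \<and> p \<noteq> q \<and>
     p \<notin> seen E c a \<and> q \<notin> seen E c b \<and> (a, b) \<notin> (bichromatic E c p q)\<^sup>*"

text \<open>No agreement with a given colouring is demanded, so edges away from \<open>u\<close> may
  be recoloured.\<close>

definition completable :: "'a set set \<Rightarrow> nat \<Rightarrow> 'a \<Rightarrow> 'a \<Rightarrow> 'a \<Rightarrow> 'a \<Rightarrow> bool" where
  "completable E k u a b v \<longleftrightarrow> (\<exists>c. acyclic_coloring (insert {u, v} (insert {u, a} (insert {u, b} E))) k c)"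

lemma fork_swap: "fork E k a b c p q \<Longrightarrow> fork E k b a c q p"
  unfolding fork_def using bichromatic_rev by (metis bichromatic_commute)

lemma completable_swap: "completable E k u b a v \<Longrightarrow> completable E k u a b v"
  unfolding completable_def by (simp add: insert_commute)

text \<open>\<open>E\<close> is the graph without a vertex \<open>u\<close> whose neighbours are
  \<open>a\<close>, \<open>b\<close> and \<open>v\<close>. Having lost an edge, \<open>a\<close> and
  \<open>b\<close> each miss at least four of the \<open>D + 3\<close> colours.\<close>

locale star =
  fixes E :: "'a set set" and k D :: nat and u a b v :: 'a
  assumes graph_edges: "graph_edges E" and fresh: "\<And>e. e \<in> E \<Longrightarrow> u \<notin> e"
    and dist: "distinct [u, a, b, v]"
    and k: "k = D + 3" "D \<ge> 3"
    and degs: "\<And>x. degree E x \<le> D" "degree E a < D" "degree E b < D"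
begin

lemma swapped: "star E k D u b a v"
  using graph_edges fresh dist k degs by unfold_locales auto

lemma seen_card: "card (seen E c x) \<le> D" "card (seen E c a) \<le> D - 1" "card (seen E c b) \<le> D - 1"
proof -
  show "card (seen E c x) \<le> D" using card_seen[OF graph_edges, of c x] degs(1)[of x] by linarith
  show "card (seen E c a) \<le> D - 1" using card_seen[OF graph_edges, of c a] degs(2) by linarith
  show "card (seen E c b) \<le> D - 1" using card_seen[OF graph_edges, of c b] degs(3) by linarith
qed

lemmas fin = finite_seen[OF graph_edges]

lemma seen_u: "seen E c u = {}"
  using fresh by (auto simp: seen_def)

text \<open>With \<open>ub\<close> present, the only way from \<open>u\<close> to \<open>a\<close>
  leads through \<open>b\<close>; a two-coloured one would use \<open>p\<close> and
  \<open>q\<close>, which \<open>fork\<close> rules out.\<close>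

lemma star_two:
  assumes f: "fork E k a b c p q"
  shows "acyclic_coloring (insert {u, a} (insert {u, b} E)) k (c({u, b} := q, {u, a} := p))"
proof -
  note F = f[unfolded fork_def]
  have ub: "{u, b} \<notin> E" using fresh by auto
  have g1: "acyclic_coloring (insert {u, b} E) k (c({u, b} := q))"
    using F dist ub fresh by (intro acyclic_coloring_insert_star) (auto simp: seen_u)
  have ua: "{u, a} \<notin> insert {u, b} E" using fresh dist by (auto simp: doubleton_eq_iff)
  have sub: "{e \<in> insert {u, b} E. u \<notin> e} = E" using fresh by auto
  have bb: "bichromatic E (c({u, b} := q)) x y = bichromatic E c x y" for x y
    using ub by (intro bichromatic_cong) auto
  have ba: "(b, a) \<notin> (bichromatic E c p q)\<^sup>*" using F bichromatic_rev by metis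
  show ?thesis
  proof (rule acyclic_coloring_insert_star[OF g1 _ ua])
    fix w assume "{u, w} \<in> insert {u, b} E"
    then have "w = b" using fresh by (auto simp: doubleton_eq_iff)
    then show "(w, a) \<notin> (bichromatic {e \<in> insert {u, b} E. u \<notin> e} (c({u, b} := q)) p ((c({u, b} := q)) {u, w}))\<^sup>*"
      unfolding sub bb using ba by simp
  qed (use F dist in \<open>auto simp: seen_insert[OF ub] seen_u\<close>)
qed

lemma star_two_seen:
  "seen (insert {u, a} (insert {u, b} E)) (c({u, b} := q, {u, a} := p)) x =
    (if x = u then {p, q} else if x = a then insert p (seen E c a)
     else if x = b then insert q (seen E c b) else seen E c x)"
proof -
  have ub: "{u, b} \<notin> E" using fresh by auto
  have ua: "{u, a} \<notin> insert {u, b} E" using fresh dist by (auto simp: doubleton_eq_iff)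
  show ?thesis unfolding seen_insert[OF ua] seen_insert[OF ub] using dist seen_u by auto
qed

text \<open>A path blocking \<open>r\<close> leaves \<open>u\<close> through \<open>a\<close> or
  \<open>b\<close>, and its second colour is that of the edge used; \<open>l\<close> excludes both
  cases.\<close>

lemma star_three:
  assumes f: "fork E k a b c p q" and r: "r < k" "r \<notin> seen E c v" "r \<noteq> p" "r \<noteq> q"
    and l: "(a, v) \<notin> (bichromatic E c r p)\<^sup>*" "(b, v) \<notin> (bichromatic E c r q)\<^sup>*"
  shows "completable E k u a b v"
proof -
  let ?E = "insert {u, a} (insert {u, b} E)" and ?c = "c({u, b} := q, {u, a} := p)"
  have uv: "{u, v} \<notin> ?E" using fresh dist by (auto simp: doubleton_eq_iff)
  have sub: "{e \<in> ?E. u \<notin> e} = E" using fresh by auto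
  have bb: "bichromatic E ?c x y = bichromatic E c x y" for x y
    using fresh by (intro bichromatic_cong) auto
  have "acyclic_coloring (insert {u, v} ?E) k (?c({u, v} := r))"
  proof (rule acyclic_coloring_insert_star[OF star_two[OF f] _ uv])
    fix w assume "{u, w} \<in> ?E"
    then have "w = a \<or> w = b" using fresh by (auto simp: doubleton_eq_iff)
    then show "(w, v) \<notin> (bichromatic {e \<in> ?E. u \<notin> e} ?c r (?c {u, w}))\<^sup>*"
      unfolding sub bb using l dist by (auto simp: doubleton_eq_iff)
  qed (use r dist in \<open>auto simp: star_two_seen\<close>)
  then show ?thesis unfolding completable_def by blast
qed

text \<open>The \<open>(r, q)\<close>-path starting at \<open>b\<close> has only one other end, so it cannot block \<open>r\<close> both for \<open>uv\<close>
  and for \<open>ua\<close>.\<close>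

lemma fork_recolor:
  assumes f: "fork E k a b c p q" and pq: "p \<in> seen E c v" "q \<in> seen E c v"
    and r: "r < k" "r \<notin> seen E c a" "r \<notin> seen E c v"
  shows "completable E k u a b v \<or> fork E k a b c r q"
proof (cases "(b, v) \<in> (bichromatic E c r q)\<^sup>*")
  case True
  note F = f[unfolded fork_def]
  have "(b, a) \<notin> (bichromatic E c r q)\<^sup>*"
    using acyclic_coloring_three_ends[OF graph_edges, of k c r b q v a] F r dist True by auto
  then have "(a, b) \<notin> (bichromatic E c r q)\<^sup>*" using bichromatic_rev by metis
  then show ?thesis using F r pq unfolding fork_def by auto
next
  case False
  have "(a, v) \<notin> (bichromatic E c r p)\<^sup>*" using f r dist by (intro unlinked) (auto simp: fork_def)
  then show ?thesis using star_three[OF f r(1,3)] pq r False by blast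
qed

end

section \<open>The third neighbour sees at most three colours\<close>

locale star3 = star +
  assumes degv: "degree E v \<le> 3"
begin

text \<open>If completion fails, each candidate colour missing at \<open>v\<close> is blocked by a
  path through \<open>a\<close>: one through \<open>b\<close> would alternate between the candidate
  and \<open>q\<close>, both missing at \<open>v\<close>. Equality in the resulting count fixes the
  colour sets at \<open>a\<close> and at all neighbours of \<open>v\<close>.\<close>

lemma one_shared:
  assumes f: "fork E k a b c p q" and q: "q \<notin> seen E c v"
  shows "completable E k u a b v"
proof (rule ccontr)
  assume nc: "\<not> ?thesis"
  let ?F = "seen E c"
  note F = f[unfolded fork_def]
  have g: "acyclic_coloring E k c" using F by blast
  have Fv: "card (?F v) \<le> 3" using card_seen[OF graph_edges, of c v] degv by linarith
  have p: "p \<in> ?F v"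
  proof (rule ccontr)
    assume p: "p \<notin> ?F v"
    have "card (?F v \<union> {p, q}) \<le> 3 + 2" using Fv by (intro order.trans[OF card_Un_le] add_mono) (auto simp: card_insert_if)
    then have "card (?F v \<union> {p, q}) < k" using k by linarith
    then obtain r where r: "r < k" "r \<notin> ?F v \<union> {p, q}"
      using pick_color[of "?F v \<union> {p, q}" k] fin by auto
    then show False using star_three[OF f r(1)] unlinked(2)[of v _ r E c] p q dist nc by auto
  qed
  define C where "C = {..<k} - insert q (?F v)"
  have kv: "insert q (?F v) \<subseteq> {..<k}" using seen_less[OF g] F by auto
  have cC: "card C = D + 3 - Suc (card (?F v))"
    unfolding C_def using kv fin q k by (subst card_Diff_subset) auto
  have linked: "(a, v) \<in> (bichromatic E c r s)\<^sup>*" if "r \<in> C" "fork E k a b c s q" "s \<in> ?F v" for r s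
  proof (rule ccontr)
    assume "\<not> ?thesis"
    moreover have "r < k" "r \<notin> ?F v" "r \<noteq> q" "r \<noteq> s" using that by (auto simp: C_def)
    ultimately show False
      using star_three[OF that(2)] unlinked(2)[of v b r E c q] q dist nc by auto
  qed
  have "C \<subseteq> ?F a"
  proof
    fix r assume "r \<in> C"
    then have "(a, v) \<in> (bichromatic E c p r)\<^sup>*" using linked f p bichromatic_commute by metis
    then show "r \<in> ?F a" using linked_seen[of a v] dist F by auto
  qed
  \<comment> \<open>\<open>C\<close> has at least \<open>D - 1\<close> elements, as \<open>v\<close>
    sees at most three colours, while \<open>a\<close> sees at most \<open>D - 1\<close>; so both
    bounds are attained.\<close>
  moreover have "card (?F a) \<le> card C" using seen_card(2)[of c] cC Fv by linarith
  ultimately have CFa: "C = ?F a" using fin by (simp add: card_seteq)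
  have c3: "card (?F v) = 3" and cD: "card C = D - 1"
    using seen_card(2)[of c] cC Fv CFa k by auto
  have disj: "C \<inter> ?F v = {}" "q \<notin> C" by (auto simp: C_def)
  \<comment> \<open>All colours at \<open>v\<close> now fit the role of \<open>p\<close>:
    \<open>a\<close> sees only \<open>C\<close>, so it misses \<open>s\<close> and \<open>q\<close>,
    and no path in these two colours starts there.\<close>
  have forks: "fork E k a b c s q" if "s \<in> ?F v" for s
  proof -
    have "s \<notin> ?F a" using that CFa disj by auto
    moreover from this have "(a, b) \<notin> (bichromatic E c s q)\<^sup>*"
      using CFa disj dist by (intro unlinked) auto
    ultimately show ?thesis using that F q seen_less[OF g] unfolding fork_def by metis
  qed
  \<comment> \<open>The blocking path for \<open>r\<close> and \<open>s\<close> reaches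
    \<open>v\<close> through \<open>x\<close>, so \<open>x\<close> sees all of \<open>C\<close>;
    together with \<open>s\<close> these are already \<open>D\<close> colours.\<close>
  have Fx: "?F x = insert s C" if x: "{v, x} \<in> E" "c {v, x} = s" for x s
  proof -
    have s: "s \<in> ?F v" using x seenI by metis
    have "C \<subseteq> ?F x"
    proof
      fix r assume r: "r \<in> C"
      have "(v, a) \<in> (bichromatic E c r s)\<^sup>*" using linked[OF r forks[OF s] s] by (rule bichromatic_rev)
      then show "r \<in> ?F x"
        using linked_seen_nb[OF g _ _ _ x] r s disj dist CFa by auto
    qed
    moreover have "s \<in> ?F x" using x seenI' by metis
    moreover have "card (insert s C) = D" using cD s disj k fin CFa by (subst card_insert_disjoint) auto
    ultimately have "insert s C \<subseteq> ?F x" "card (?F x) \<le> card (insert s C)" using seen_card(1)[of c x] by auto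
    then show ?thesis using fin by (metis card_seteq)
  qed
  obtain s where s: "s \<in> ?F v" "s \<noteq> p"
  proof -
    have "\<not> ?F v \<subseteq> {p}" using c3 card_mono[of "{p}" "?F v"] by auto
    then show thesis using that by blast
  qed
  obtain x where x: "{v, x} \<in> E" "c {v, x} = p" "x \<noteq> v" using seenE[OF graph_edges p] .
  obtain y where y: "{v, y} \<in> E" "c {v, y} = s" "y \<noteq> v" using seenE[OF graph_edges s(1)] .
  have xy: "x \<noteq> y" using x y s by auto
  have Fxy: "?F x = insert p C" "?F y = insert s C" using Fx x y by auto
  \<comment> \<open>Exchange the colours of \<open>vx\<close> and \<open>vy\<close>: the \<open>(r, p)\<close>-path from \<open>a\<close>, which used to reach \<open>v\<close>,
    then ends at \<open>x\<close>.\<close>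
  let ?E2 = "E - {{v, x}} - {{v, y}}"
  let ?c1 = "c({v, x} := s)" and ?c2 = "c({v, x} := s, {v, y} := p)"
  have g1: "acyclic_coloring (E - {{v, x}}) k c" using g by (rule acyclic_coloring_subset) auto
  have g2: "acyclic_coloring ?E2 k c" using g by (rule acyclic_coloring_subset) auto
  have y1: "{v, y} \<in> E - {{v, x}}" using y xy by (auto simp: doubleton_eq_iff)
  have F2: "seen ?E2 c w = (if w = v then ?F v - {p, s} else if w = x \<or> w = y then C
      else ?F w)" for w
    unfolding seen_remove[OF g1 y1] seen_remove[OF g x(1)] using x y xy Fxy s p disj by auto
  have vx2: "{v, x} \<notin> ?E2" by auto
  \<comment> \<open>Without the two edges \<open>x\<close> and \<open>y\<close> see only
    \<open>C\<close>, which is disjoint from the colours at \<open>v\<close>; so putting them back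
    with exchanged colours closes no two-coloured cycle.\<close>
  have g3: "acyclic_coloring (insert {v, x} ?E2) k ?c1"
  proof (rule acyclic_coloring_insert_seen[OF g2 _ vx2])
    fix w assume w: "{x, w} \<in> ?E2" "c {x, w} \<in> seen ?E2 c v"
    then have "c {x, w} \<in> seen ?E2 c x" using seenI by metis
    then show "s \<notin> seen ?E2 c w" using w disj unfolding F2 using x by auto
  qed (use x s disj seen_less[OF g] in \<open>auto simp: F2\<close>)
  have F3: "seen (insert {v, x} ?E2) ?c1 w = (if w = v then ?F v - {p} else if w = x then insert s C
     else if w = y then C else ?F w)" for w
    unfolding seen_insert[OF vx2] F2 using x y xy s p by auto
  have vy3: "{v, y} \<notin> insert {v, x} ?E2" using x y xy by (auto simp: doubleton_eq_iff)
  have g4: "acyclic_coloring (insert {v, y} (insert {v, x} ?E2)) k ?c2"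
  proof (rule acyclic_coloring_insert_seen[OF g3 _ vy3])
    fix w assume w: "{y, w} \<in> insert {v, x} ?E2" "?c1 {y, w} \<in> seen (insert {v, x} ?E2) ?c1 v"
    then have "?c1 {y, w} \<in> seen (insert {v, x} ?E2) ?c1 y" using seenI by metis
    then show "p \<notin> seen (insert {v, x} ?E2) ?c1 w" using w disj y xy unfolding F3 by auto
  qed (use x y xy p disj seen_less[OF g] in \<open>auto simp: F3\<close>)
  have E4: "insert {v, y} (insert {v, x} ?E2) = E" using x y by auto
  have F4: "seen E ?c2 w = (if w = v then ?F v else if w = x then insert s C
     else if w = y then insert p C else ?F w)" for w
    using seen_insert[OF vy3, of ?c1 p w] unfolding E4 F3 using x y xy p by auto
  have g': "acyclic_coloring E k ?c2" using g4 E4 by simp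
  have ax: "a \<noteq> x" "a \<noteq> y" using Fxy CFa disj s p by auto
  have Fa: "seen E ?c2 a = C" using F4 ax dist CFa by auto
  have qb: "q \<notin> seen E ?c2 b" using F4[of b] dist q s p disj F by auto
  have f': "fork E k a b ?c2 p q" unfolding fork_def
    using g' F qb Fa disj p unlinked(1)[of a b p E ?c2 q] dist by auto
  obtain r where r: "r \<in> C" using cD k by fastforce
  have rv: "r \<notin> seen E ?c2 v" "q \<notin> seen E ?c2 v" using F4 r q disj by auto
  have "(a, v) \<notin> (bichromatic E ?c2 r p)\<^sup>*"
  proof
    assume av: "(a, v) \<in> (bichromatic E ?c2 r p)\<^sup>*"
    have va: "(v, a) \<in> (bichromatic E c r p)\<^sup>*" using bichromatic_rev[OF linked[OF r f p]] .
    have vx: "(v, x) \<in> bichromatic E c r p" using x by (auto simp: bichromatic_def)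
    have un: "\<And>z. (v, z) \<in> bichromatic E c r p \<Longrightarrow> z = x" using bichromatic_end[OF g disjI1 _ vx] r disj by blast
    have "(x, a) \<in> (bichromatic E c r p - {(v, x), (x, v)})\<^sup>*"
      using rtrancl_leaf[OF va un] dist by auto
    moreover have "bichromatic E c r p - {(v, x), (x, v)} \<subseteq> bichromatic E ?c2 r p"
      using x y s r disj by (auto simp: bichromatic_def doubleton_eq_iff)
    ultimately have "(x, a) \<in> (bichromatic E ?c2 r p)\<^sup>*" by (metis rtrancl_mono subsetD)
    then have xa: "(a, x) \<in> (bichromatic E ?c2 r p)\<^sup>*" by (rule bichromatic_rev)
    \<comment> \<open>If \<open>r\<close> were still blocked, \<open>a\<close>, \<open>x\<close> and
      \<open>v\<close> would be three ends in one component: the first two miss \<open>p\<close>,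
      the last misses \<open>r\<close>.\<close>
    have "p \<notin> seen E ?c2 a" "p \<notin> seen E ?c2 x" using Fa F4 p s x xy disj by auto
    then show False using acyclic_coloring_three_ends[OF graph_edges g' _ _ _ _ _ _ xa av] rv ax x dist by auto
  qed
  moreover have "(b, v) \<notin> (bichromatic E ?c2 r q)\<^sup>*" using unlinked(2)[of v b r E ?c2 q] rv dist by auto
  moreover have "r < k" "r \<noteq> p" "r \<noteq> q" using r p disj by (auto simp: C_def)
  ultimately show False using star_three[OF f' _ rv(1)] nc by blast
qed

text \<open>If both colours occur at \<open>v\<close>, some colour is missing at \<open>a\<close>
  and at \<open>v\<close>, because \<open>(D - 1) + 3 < D + 3\<close>; using it for
  \<open>ua\<close> leaves at most one shared colour.\<close>

lemma complete:
  assumes f: "fork E k a b c p q"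
  shows "completable E k u a b v"
proof -
  interpret sw: star3 E k D u b a v
    using swapped degv by (simp add: star3_def star3_axioms_def)
  have aux: "completable E k u a b v" if "fork E k a b c p' q'" "p' \<notin> seen E c v" for p' q'
    by (rule completable_swap, rule sw.one_shared[OF fork_swap[OF that(1)] that(2)])
  show ?thesis
  proof (cases "p \<in> seen E c v \<and> q \<in> seen E c v")
    case True
    have "card (seen E c v) \<le> 3" using card_seen[OF graph_edges, of c v] degv by linarith
    then have "card (seen E c a \<union> seen E c v) < k"
      using card_Un_le[of "seen E c a" "seen E c v"] seen_card(2)[of c] k by linarith
    then obtain r where "r < k" "r \<notin> seen E c a \<union> seen E c v"
      using pick_color[of "seen E c a \<union> seen E c v" k] fin by auto
    then show ?thesis using fork_recolor[OF f, of r] True aux by blast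
  next
    case False
    then show ?thesis using aux one_shared f by blast
  qed
qed

end

section \<open>The third neighbour has degree 5 and four neighbours of degree 3\<close>

lemma seen_nb:
  assumes "graph_edges E"
  shows "seen E c x = (\<lambda>w. c {x, w}) ` {w. {x, w} \<in> E}"
proof -
  have "q \<in> (\<lambda>w. c {x, w}) ` {w. {x, w} \<in> E}" if "q \<in> seen E c x" for q
    using seenE[OF assms that] by auto
  then show ?thesis by (auto simp: seen_def)
qed

text \<open>In the whole graph \<open>v\<close> has the neighbours \<open>u\<close>,
  \<open>z\<close> and the three vertices of \<open>X\<close>. The degree bound on \<open>X\<close>
  refers to the graph with \<open>ua\<close> and \<open>ub\<close>, as \<open>a\<close> or
  \<open>b\<close> may lie in \<open>X\<close>.\<close>

locale star5 = star +
  fixes X :: "'a set" and z :: 'a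
  assumes X: "card X = 3" "z \<notin> X" "\<And>w. {v, w} \<in> E \<longleftrightarrow> w \<in> insert z X"
    and D5: "D \<ge> 5"
    and small: "\<And>x. x \<in> X \<Longrightarrow> degree (insert {u, a} (insert {u, b} E)) x \<le> 3"
begin

abbreviation "E0 \<equiv> insert {u, a} (insert {u, b} E)"

lemma finX: "finite X" using X(1) by (metis card.infinite zero_neq_numeral)

lemma graph_edges0: "graph_edges E0" using graph_edges dist by (intro graph_edges_insert) auto

lemma v_nb: "v \<notin> insert z X"
  using X(3)[of v] graph_edges by (auto simp: graph_edges_def)

lemma u_nb: "u \<notin> insert z X"
  using X(3)[of u] fresh by auto

lemma X0: "{v, w} \<in> E0 \<longleftrightarrow> w \<in> insert z X"
  using X(3)[of w] dist by (auto simp: doubleton_eq_iff)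

lemma swapped5: "star5 E k D u b a v X z"
proof -
  have "insert {u, b} (insert {u, a} E) = E0" by auto
  then show ?thesis
    using swapped X D5 small by (simp add: star5_def star5_axioms_def)
qed

lemma small_card0: "x \<in> X \<Longrightarrow> card (seen E0 c x) \<le> 3"
  using card_seen[OF graph_edges0, of c x] small[of x] by linarith

lemma small_card: "x \<in> X \<Longrightarrow> card (seen E c x) \<le> 3"
proof -
  have "seen E c x \<subseteq> seen E0 c x" by (auto simp: seen_def)
  then have "card (seen E c x) \<le> card (seen E0 c x)" using finite_seen[OF graph_edges0] by (rule card_mono[rotated])
  then show "x \<in> X \<Longrightarrow> card (seen E c x) \<le> 3" using small_card0[of x c] by linarith
qed

lemma seen_v: "seen E c v = insert (c {v, z}) ((\<lambda>x. c {v, x}) ` X)"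
  unfolding seen_nb[OF graph_edges] X(3) by auto

lemma seen_v0: "seen E0 c v = insert (c {v, z}) ((\<lambda>x. c {v, x}) ` X)"
  unfolding seen_nb[OF graph_edges0] X0 by auto

text \<open>\<open>u\<close> and \<open>v\<close> can share only \<open>p\<close>, and then it lies
  on an edge \<open>vx\<close> with \<open>x\<close> in \<open>X\<close>. Besides \<open>q\<close>
  and the at most four colours at \<open>v\<close>, only the other colours at \<open>x\<close> must
  be avoided, at most two: seven out of at least eight.\<close>

lemma small_colors:
  assumes g: "acyclic_coloring E0 k c" and u: "seen E0 c u = {p, q}" and q: "q \<notin> seen E0 c v"
    and z: "c {v, z} \<noteq> p"
  shows "completable E k u a b v"
proof -
  have "card ((\<lambda>x. c {v, x}) ` X) \<le> 3" using card_image_le[OF finX] X(1) by metis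
  then have c4: "card (seen E0 c v) \<le> 4"
    unfolding seen_v0 using finX by (simp add: card_insert_if)
  have uv: "{u, v} \<notin> E0" using fresh dist by (auto simp: doubleton_eq_iff)
  have pk: "p < k" "q < k" using seen_less[OF g] u by auto
  have main: "completable E k u a b v"
    if r: "r < k" "r \<notin> seen E0 c v" "r \<noteq> p" "r \<noteq> q"
      and nx: "\<And>x. x \<in> X \<Longrightarrow> c {v, x} = p \<Longrightarrow> r \<notin> seen E0 c x" for r
  proof -
    have "acyclic_coloring (insert {u, v} E0) k (c({u, v} := r))"
    proof (rule acyclic_coloring_insert_seen[OF g _ uv r(1) _ r(2)])
      fix w assume w: "{v, w} \<in> E0" "c {v, w} \<in> seen E0 c u"
      then have "c {v, w} = p" using u q seenI[OF w(1), of c] by auto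
      moreover have "w \<in> X" using X0 w z \<open>c {v, w} = p\<close> by auto
      ultimately show "r \<notin> seen E0 c w" using nx by blast
    qed (use r u dist in auto)
    then show ?thesis unfolding completable_def by blast
  qed
  show ?thesis
  proof (cases "p \<in> seen E0 c v")
    case False
    have "card (insert p (insert q (seen E0 c v))) \<le> 6"
      using c4 finite_seen[OF graph_edges0] by (simp add: card_insert_if)
    then have "card (insert p (insert q (seen E0 c v))) < k" using k D5 by linarith
    moreover have "finite (insert p (insert q (seen E0 c v)))" using finite_seen[OF graph_edges0] by blast
    ultimately obtain r where "r < k" "r \<notin> insert p (insert q (seen E0 c v))" by (rule pick_color)
    moreover have "c {v, x} \<noteq> p" if "x \<in> X" for x using False that unfolding seen_v0 by auto
    ultimately show ?thesis using main by blast
  next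
    case True
    then obtain x where x: "x \<in> X" "c {v, x} = p" using z unfolding seen_v0 by auto
    have xE: "{v, x} \<in> E0" using X0 x by blast
    let ?G = "seen E0 c x - {p}"
    have "p \<in> seen E0 c x" using seenI'[OF xE, of c] x by simp
    then have "card ?G \<le> 2" using small_card0[OF x(1), of c] by (simp add: card_Diff_singleton)
    moreover have "card (insert q (seen E0 c v)) \<le> 5"
      using c4 finite_seen[OF graph_edges0] by (simp add: card_insert_if)
    ultimately have "card (insert q (seen E0 c v) \<union> ?G) < k"
      using card_Un_le[of "insert q (seen E0 c v)" ?G] k D5 by linarith
    moreover have "finite (insert q (seen E0 c v) \<union> ?G)" using finite_seen[OF graph_edges0] by blast
    ultimately obtain r where r: "r < k" "r \<notin> insert q (seen E0 c v) \<union> ?G" by (rule pick_color)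
    show ?thesis
    proof (rule main[of r])
      fix y assume y: "y \<in> X" "c {v, y} = p"
      have "{v, y} \<in> E0" using y(1) X0[of y] by (metis insertI2)
      then have "y = x" using acyclic_coloring_unique[OF g _ xE] x y by metis
      then show "r \<notin> seen E0 c y" using r True by auto
    qed (use r True in auto)
  qed
qed

text \<open>Used in contraposition: if completion fails and the second colour is missing at
  \<open>v\<close>, the first must be that of \<open>vz\<close>.\<close>

lemma small_fork:
  assumes f: "fork E k a b c p q" and q: "q \<notin> seen E c v" and p: "p \<noteq> c {v, z}"
  shows "completable E k u a b v"
proof (rule small_colors[OF star_two[OF f]])
  show "seen E0 (c({u, b} := q, {u, a} := p)) u = {p, q}" unfolding star_two_seen by simp
  show "q \<notin> seen E0 (c({u, b} := q, {u, a} := p)) v" unfolding star_two_seen using q dist by auto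
  show "(c({u, b} := q, {u, a} := p)) {v, z} \<noteq> p" using p dist by (auto simp: doubleton_eq_iff)
qed

lemma colors_v:
  assumes g: "acyclic_coloring E k c"
  shows "card ((\<lambda>x. c {v, x}) ` X) = 3" "c {v, z} \<notin> (\<lambda>x. c {v, x}) ` X"
    "card (seen E c v) = 4"
proof -
  have inj: "inj_on (\<lambda>x. c {v, x}) (insert z X)"
    using acyclic_coloring_unique[OF g] X(3) by (auto simp: inj_on_def)
  then show "card ((\<lambda>x. c {v, x}) ` X) = 3" using X(1) by (simp add: card_image)
  moreover show n: "c {v, z} \<notin> (\<lambda>x. c {v, x}) ` X" using inj X(2) by auto
  ultimately show "card (seen E c v) = 4" unfolding seen_v using finX by (simp add: card_insert_if)
qed

text \<open>Give \<open>vz\<close> the colour of some \<open>vx\<close>, \<open>x \<in> X\<close>, and \<open>vx\<close> a new colour; then \<open>u\<close> and \<open>v\<close> share at most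
  the new colour. At most seven colours are excluded for \<open>vx\<close>, out of at least eight.\<close>

lemma recolor_center:
  assumes g: "acyclic_coloring E0 k c" and u: "seen E0 c u = {c {v, z}, q}" and q: "q \<notin> seen E0 c v"
    and zS: "\<And>x. x \<in> X \<Longrightarrow> c {v, x} \<notin> seen E0 c z"
  shows "completable E k u a b v"
proof -
  let ?F = "seen E0 c"
  obtain x1 x2 x3 where XX: "X = {x1, x2, x3}" and d: "x1 \<noteq> x2" "x1 \<noteq> x3" "x2 \<noteq> x3"
    using X(1) by (auto simp: card_3_iff)
  define j i m where "j = c {v, x1}" and "i = c {v, x2}" and "m = c {v, x3}"
  let ?t = "c {v, z}"
  have vE: "{v, x1} \<in> E0" "{v, x2} \<in> E0" "{v, x3} \<in> E0" "{v, z} \<in> E0" using X0 XX by auto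
  have ne: "z \<noteq> x1" "z \<noteq> x2" "z \<noteq> x3" "v \<noteq> x1" "v \<noteq> x2" "v \<noteq> x3" "v \<noteq> z" "u \<noteq> v" "u \<noteq> z" "u \<noteq> x1"
    using X(2) XX v_nb u_nb dist by auto
  have cd: "j \<noteq> i" "j \<noteq> m" "i \<noteq> m" "?t \<noteq> j" "?t \<noteq> i" "?t \<noteq> m"
    using acyclic_coloring_unique[OF g vE(1) vE(2)] acyclic_coloring_unique[OF g vE(1) vE(3)] acyclic_coloring_unique[OF g vE(2) vE(3)]
      acyclic_coloring_unique[OF g vE(4) vE(1)] acyclic_coloring_unique[OF g vE(4) vE(2)] acyclic_coloring_unique[OF g vE(4) vE(3)] d ne
    unfolding j_def i_def m_def by auto
  have Fv: "?F v = {?t, j, i, m}" unfolding seen_v0 XX j_def i_def m_def by auto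
  have fin0: "finite (?F w)" for w using finite_seen[OF graph_edges0] .
  have rest: "card (?F x - {c {v, x}}) \<le> 2" if "x \<in> X" for x
  proof -
    have "c {v, x} \<in> ?F x" using X0[of x] that seenI'[of v x E0 c] by blast
    then show ?thesis using small_card0[OF that, of c] by (simp add: card_Diff_singleton)
  qed
  define G where "G = ?F x1 - {j}"
  \<comment> \<open>If \<open>x1\<close> sees \<open>i\<close>, a path in \<open>e\<close> and
    \<open>i\<close> could run through \<open>v\<close> and \<open>x2\<close>, so \<open>e\<close>
    must be missing at \<open>x2\<close>; likewise \<open>m\<close> and \<open>x3\<close>. Such an
    \<open>i\<close> or \<open>m\<close> is excluded anyway and is traded for at most two colours,
    so \<open>H\<close> has at most four.\<close>
  define H where "H = (G - {i, m}) \<union> (if i \<in> G then ?F x2 - {i} else {}) \<union> (if m \<in> G then ?F x3 - {m} else {})"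
  have G2: "card G \<le> 2" "finite G" using rest[of x1] XX fin0 unfolding G_def j_def by auto
  have g23: "card (?F x2 - {i}) \<le> 2" "card (?F x3 - {m}) \<le> 2"
    using rest[of x2] rest[of x3] XX unfolding i_def m_def by auto
  have Gim: "card (G - {i, m}) = card G - (if i \<in> G then 1 else 0) - (if m \<in> G then 1 else 0)"
  proof -
    have "G - {i, m} = G - {i} - {m}" by auto
    then show ?thesis using G2 cd by (simp add: card_Diff_singleton_if)
  qed
  have "card H \<le> card (G - {i, m}) + card (if i \<in> G then ?F x2 - {i} else {})
      + card (if m \<in> G then ?F x3 - {m} else {})"
    unfolding H_def by (intro order.trans[OF card_Un_le] add_right_mono card_Un_le)
  also have "\<dots> \<le> 4" using Gim G2 g23 by (auto split: if_splits)
  finally have "card H \<le> 4" .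
  moreover have "card {i, j, m} \<le> 3" using cd by auto
  ultimately have "card ({i, j, m} \<union> H) < k"
    using card_Un_le[of "{i, j, m}" H] k D5 by linarith
  moreover have "finite ({i, j, m} \<union> H)" using fin0 G2(2) unfolding H_def by simp
  ultimately obtain e where e: "e < k" "e \<notin> {i, j, m} \<union> H" by (rule pick_color)
  have eG: "e \<notin> G" using e unfolding H_def by auto
  have e2: "i \<in> G \<Longrightarrow> e \<notin> ?F x2" and e3: "m \<in> G \<Longrightarrow> e \<notin> ?F x3" using e unfolding H_def by auto
  have Fz: "j \<notin> ?F z" "i \<notin> ?F z" "m \<notin> ?F z" using zS XX unfolding j_def i_def m_def by auto
  let ?E1 = "E0 - {{v, z}}" and ?E2 = "E0 - {{v, z}} - {{v, x1}}"
  have g1: "acyclic_coloring ?E1 k c" and g2: "acyclic_coloring ?E2 k c" by (rule acyclic_coloring_subset[OF g], auto)+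
  have x1E: "{v, x1} \<in> ?E1" using vE ne by (auto simp: doubleton_eq_iff)
  have F2: "seen ?E2 c w = (if w = v then {i, m} else if w = z then ?F z - {?t}
      else if w = x1 then G else ?F w)" for w
    unfolding seen_remove[OF g1 x1E] seen_remove[OF g vE(4)] using ne cd Fv
    by (auto simp: G_def j_def[symmetric] seen_def)
  let ?c1 = "c({v, z} := j)" and ?c2 = "c({v, z} := j, {x1, v} := e)"
  have vz: "{v, z} \<notin> ?E2" by auto
  have jk: "j < k" using acyclic_coloringD_less[OF g vE(1)] by (simp add: j_def)
  \<comment> \<open>At this stage \<open>v\<close> sees only \<open>i\<close> and \<open>m\<close>,
    both missing at \<open>z\<close>, so no two-coloured cycle can pass through
    \<open>vz\<close>.\<close>
  have g3: "acyclic_coloring (insert {v, z} ?E2) k ?c1"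
  proof (rule acyclic_coloring_insert_seen[OF g2 _ vz jk])
    fix w assume w: "{z, w} \<in> ?E2" "c {z, w} \<in> seen ?E2 c v"
    then have "c {z, w} \<in> seen ?E2 c z" using seenI by metis
    then show "j \<notin> seen ?E2 c w" using w Fz ne unfolding F2 by auto
  qed (use Fz ne cd in \<open>auto simp: F2\<close>)
  have F3: "seen (insert {v, z} ?E2) ?c1 w = (if w = v then {i, m, j} else if w = z then insert j (?F z - {?t})
      else if w = x1 then G else ?F w)" for w
    unfolding seen_insert[OF vz] F2 using ne by auto
  have x1v: "{x1, v} \<notin> insert {v, z} ?E2" using ne by (auto simp: doubleton_eq_iff)
  have g4: "acyclic_coloring (insert {x1, v} (insert {v, z} ?E2)) k ?c2"
  proof (rule acyclic_coloring_insert_seen[OF g3 _ x1v e(1)])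
    fix w assume w: "{v, w} \<in> insert {v, z} ?E2" "?c1 {v, w} \<in> seen (insert {v, z} ?E2) ?c1 x1"
    have wX: "w = z \<or> w = x2 \<or> w = x3" using w(1) X0[of w] XX ne by (auto simp: doubleton_eq_iff)
    have cG: "?c1 {v, w} \<in> G" using w(2) ne unfolding F3 by auto
    have "w \<noteq> z" using cG unfolding G_def by auto
    then have cw: "?c1 {v, w} = c {v, w}" by (auto simp: doubleton_eq_iff)
    show "e \<notin> seen (insert {v, z} ?E2) ?c1 w"
      using wX \<open>w \<noteq> z\<close> cG cw e2 e3 ne d XX v_nb unfolding F3 i_def m_def by auto
  qed (use ne e eG in \<open>auto simp: F3\<close>)
  have E4: "insert {x1, v} (insert {v, z} ?E2) = E0"
  proof -
    have "insert B (insert A (S - {A} - {B})) = S" if "A \<in> S" "B \<in> S" for A B :: "'a set" and S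
      using that by auto
    from this[OF vE(4,1)] show ?thesis by (simp only: insert_commute[of x1 v "{}"])
  qed
  have F4: "seen E0 ?c2 w = (if w = x1 \<or> w = v then insert e (seen (insert {v, z} ?E2) ?c1 w)
      else seen (insert {v, z} ?E2) ?c1 w)" for w
    using seen_insert[OF x1v, of ?c1 e w] by (simp only: E4)
  have g': "acyclic_coloring E0 k ?c2" using g4 E4 by simp
  have Fu: "seen E0 ?c2 u = {?t, q}" unfolding F4 F3 using u ne by auto
  have Fv': "seen E0 ?c2 v = {i, m, j, e}" unfolding F4 F3 using ne by auto
  have qn: "q \<noteq> ?t" "q \<noteq> i" "q \<noteq> m" "q \<noteq> j" using q Fv by auto
  have cz: "?c2 {v, z} = j" using ne by (auto simp: doubleton_eq_iff)
  have Fu': "seen E0 ?c2 u = {q, ?t}" using Fu by auto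
  show ?thesis
  \<comment> \<open>\<open>u\<close> and \<open>v\<close> can share only \<open>e\<close>, which
    lies on the edge from \<open>v\<close> to \<open>x1\<close>; the cases select a colour at
    \<open>u\<close> that \<open>v\<close> misses.\<close>
  proof (cases "q = e")
    case True
    then show ?thesis
      using small_colors[OF g', of q ?t] Fu' Fv' qn cd cz by auto
  next
    case False
    then show ?thesis
      using small_colors[OF g', of ?t q] Fu Fv' qn cd cz by auto
  qed
qed

lemma one_shared:
  assumes f: "fork E k a b c p q" and q: "q \<notin> seen E c v"
  shows "completable E k u a b v"
proof (rule ccontr)
  assume nc: "\<not> ?thesis"
  let ?F = "seen E c" and ?S = "(\<lambda>x. c {v, x}) ` X"
  note F = f[unfolded fork_def]
  have g: "acyclic_coloring E k c" using F by blast
  have pz: "p = c {v, z}" using small_fork[OF f q] nc by blast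
  note cv = colors_v[OF g]
  define C where "C = {..<k} - insert q (?F v)"
  have kv: "insert q (?F v) \<subseteq> {..<k}" using seen_less[OF g] F by auto
  have cC: "card C = D - 2"
    unfolding C_def using kv fin q k cv(3) by (subst card_Diff_subset) auto
  have finC: "finite C" by (auto simp: C_def)
  have pv: "p \<in> ?F v" using seen_v pz by auto
  have SC: "C \<inter> ?S = {}" "finite ?S" "?S \<subseteq> ?F v" "p \<notin> C" "q \<notin> C" "p \<notin> ?S" "q \<notin> ?S"
    using finX seen_v cv(2) pz pv q by (auto simp: C_def)
  have zE: "{v, z} \<in> E" using X(3) by blast
  have linked: "(a, v) \<in> (bichromatic E c r p)\<^sup>*" if "r \<in> C" for r
  proof (rule ccontr)
    assume "\<not> ?thesis"
    moreover have "r < k" "r \<notin> ?F v" "r \<noteq> q" "r \<noteq> p" using that SC by (auto simp: C_def)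
    ultimately show False
      using star_three[OF f] unlinked(2)[of v b r E c q] q dist nc by auto
  qed
  have to_z: "r \<in> ?F z" if "(a, v) \<in> (bichromatic E c r p)\<^sup>*" "r \<notin> ?F v" for r
    using linked_seen_nb[OF g bichromatic_rev[OF that(1)] _ that(2) zE] pz F dist by auto
  have Ca: "C \<subseteq> ?F a"
  proof
    fix r assume "r \<in> C"
    then have "(a, v) \<in> (bichromatic E c p r)\<^sup>*" using linked bichromatic_commute by metis
    then show "r \<in> ?F a" using linked_seen[of a v] dist F by auto
  qed
  have CS: "card (C \<union> ?S) = D + 1"
    using card_Un_disjoint[OF finC SC(2,1)] cC cv(1) D5 by linarith
  \<comment> \<open>Such an \<open>s\<close> could replace \<open>p\<close> on \<open>ua\<close>; as
    it is not the colour of \<open>vz\<close>, completion would succeed.\<close>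
  have noS: False if "s \<in> ?S" "s \<notin> ?F a" "q \<notin> ?F a \<or> s \<notin> ?F b" for s
  proof -
    have "(a, b) \<notin> (bichromatic E c s q)\<^sup>*"
      using that(3) unlinked(1)[of a b s E c q] unlinked(2)[of b a s E c q] that(2) F dist by auto
    then have f': "fork E k a b c s q"
      using that SC F seen_less[OF g] unfolding fork_def by blast
    have "s \<noteq> c {v, z}" using that(1) SC(6) pz by metis
    then show False using small_fork[OF f' q] nc by blast
  qed
  have qa: "q \<in> ?F a"
  proof (rule ccontr)
    assume "q \<notin> ?F a"
    then have "C \<union> ?S \<subseteq> ?F a" using noS Ca by blast
    then have "card (C \<union> ?S) \<le> card (?F a)" using fin by (simp only: card_mono)
    then show False using CS seen_card(2)[of c] by linarith
  qed
  have "card (insert q C) = D - 1" using cC finC SC D5 by auto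
  then have Fa: "insert q C = ?F a"
    using qa Ca seen_card(2)[of c] fin by (intro card_seteq) auto
  have "?S \<inter> ?F a = {}" using Fa[symmetric] SC by auto
  then have Sb: "?S \<subseteq> ?F b" using noS by blast
  \<comment> \<open>\<open>b\<close> sees all of \<open>?S\<close> but at most \<open>D - 1\<close>
    colours, while \<open>C\<close> and \<open>?S\<close> together have
    \<open>D + 1\<close>.\<close>
  obtain r where r: "r \<in> C" "r \<notin> ?F b"
  proof -
    have "\<not> C \<subseteq> ?F b"
    proof
      assume "C \<subseteq> ?F b"
      then have "C \<union> ?S \<subseteq> ?F b" using Sb by blast
      then have "card (C \<union> ?S) \<le> card (?F b)" using fin by (simp only: card_mono)
      then show False using CS seen_card(3)[of c] by linarith
    qed
    then show thesis using that by blast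
  qed
  have rC: "r < k" "r \<noteq> p" "r \<noteq> q" "r \<notin> ?F v" using r SC by (auto simp: C_def)
  \<comment> \<open>The path from \<open>a\<close> in colours \<open>r\<close> and \<open>p\<close>
    already ends at \<open>v\<close>, so it cannot end at \<open>b\<close>. Hence \<open>r\<close>
    may replace \<open>q\<close> on \<open>ub\<close>, which frees \<open>q\<close> for
    \<open>uv\<close>.\<close>
  have "(a, b) \<notin> (bichromatic E c r p)\<^sup>*"
    using acyclic_coloring_three_ends[OF graph_edges g _ _ _ _ _ _ _ linked[OF r(1)], of b] r rC F dist by auto
  then have f': "fork E k a b c p r"
    using F rC r bichromatic_commute unfolding fork_def by metis
  have "(a, v) \<in> (bichromatic E c q p)\<^sup>*"
    using star_three[OF f', of q] unlinked(2)[of v b q E c r] F q rC nc dist by auto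
  then have "q \<in> ?F z" using to_z q by blast
  moreover have "C \<subseteq> ?F z" using to_z linked by (auto simp: C_def)
  moreover have "p \<in> ?F z" using seenI'[OF zE, of c] pz by simp
  moreover have "card (insert p (insert q C)) = D" using cC finC SC D5 F by auto
  \<comment> \<open>These are \<open>D\<close> colours, so \<open>z\<close> sees nothing else and in
    particular no colour of \<open>?S\<close>.\<close>
  ultimately have Fz: "insert p (insert q C) = ?F z"
    using seen_card(1)[of c z] fin by (intro card_seteq) auto
  let ?c = "c({u, b} := q, {u, a} := p)"
  have z: "z \<noteq> a" "z \<noteq> b" "z \<noteq> u" using Fz F u_nb by auto
  have cc: "?c {v, w} = c {v, w}" for w using dist by (auto simp: doubleton_eq_iff)
  have "completable E k u a b v"
  proof (rule recolor_center[OF star_two[OF f]])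
    show "seen E0 ?c u = {?c {v, z}, q}" unfolding star_two_seen cc using pz by simp
    show "q \<notin> seen E0 ?c v" unfolding star_two_seen using q dist by auto
    fix x assume "x \<in> X"
    then have "c {v, x} \<in> ?S" by auto
    then show "?c {v, x} \<notin> seen E0 ?c z"
      unfolding star_two_seen cc using z SC Fz[symmetric] by auto
  qed
  then show False using nc by blast
qed

text \<open>If completion fails, both colours of every fork occur at \<open>v\<close>, so no colour
  missing at \<open>v\<close> is missing at \<open>a\<close> or \<open>b\<close>. Exactly
  \<open>D - 1\<close> colours are missing at \<open>v\<close>, hence these are precisely the
  colours at \<open>a\<close> and at \<open>b\<close>.\<close>

lemma complete:
  assumes f: "fork E k a b c p q"
  shows "completable E k u a b v"
proof (rule ccontr)
  assume nc: "\<not> ?thesis"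
  interpret sw: star5 E k D u b a v X z by (rule swapped5)
  let ?F = "seen E c"
  note F = f[unfolded fork_def]
  have g: "acyclic_coloring E k c" using F by blast
  have nc': "\<not> completable E k u b a v" using nc completable_swap by metis
  have shared: "p' \<in> ?F v \<and> q' \<in> ?F v" if "fork E k a b c p' q'" for p' q'
    using that one_shared sw.one_shared fork_swap nc nc' by metis
  define C where "C = {..<k} - ?F v"
  have kv: "?F v \<subseteq> {..<k}" using seen_less[OF g] by auto
  have cC: "card C = D - 1"
    unfolding C_def using kv fin k colors_v[OF g] by (subst card_Diff_subset) auto
  have "r \<in> ?F a" if "r \<in> C" for r
    using fork_recolor[OF f, of r] shared f nc that by (auto simp: C_def)
  then have Fa: "C = ?F a" using seen_card(2)[of c] cC fin by (intro card_seteq) auto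
  have "r \<in> ?F b" if "r \<in> C" for r
  proof (rule ccontr)
    assume n: "r \<notin> ?F b"
    have r: "r < k" "r \<notin> ?F v" using that by (auto simp: C_def)
    have "fork E k b a c r p"
      using sw.fork_recolor[OF fork_swap[OF f] _ _ r(1) n r(2)] shared[OF f] nc' by blast
    then show False using shared[OF fork_swap] r by blast
  qed
  then have Fb: "C = ?F b" using seen_card(3)[of c] cC fin by (intro card_seteq) auto
  \<comment> \<open>Now any two colours of edges from \<open>v\<close> to \<open>X\<close> can be used at \<open>ua\<close> and \<open>ub\<close>. If all choices fail,
    every colour in \<open>C\<close> occurs at two of the three vertices of \<open>X\<close>, each of which has at most two
    such colours.\<close>
  have cover: "r \<in> ?F x \<or> r \<in> ?F y" if r: "r \<in> C" and xy: "x \<in> X" "y \<in> X" "x \<noteq> y" for r x y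
  proof (rule ccontr)
    assume n: "\<not> ?thesis"
    have E: "{v, x} \<in> E" "{v, y} \<in> E" using X(3) xy by auto
    let ?s = "c {v, x}" and ?t = "c {v, y}"
    have st: "?s \<noteq> ?t" using acyclic_coloring_unique[OF g E] xy by auto
    have stF: "?s \<in> ?F v" "?t \<in> ?F v" using E seenI by metis+
    have nC: "?s \<notin> C" "?t \<notin> C" using stF by (auto simp: C_def)
    have "(a, b) \<notin> (bichromatic E c ?s ?t)\<^sup>*" using Fa nC dist by (intro unlinked(1)) auto
    then have f': "fork E k a b c ?s ?t"
      using g st nC Fa Fb stF seen_less[OF g] unfolding fork_def by blast
    have rv: "r < k" "r \<notin> ?F v" using r by (auto simp: C_def)
    have "(a, v) \<notin> (bichromatic E c r ?s)\<^sup>*"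
      using linked_seen_nb[OF g bichromatic_rev _ rv(2) E(1) refl] n nC Fa dist by auto
    moreover have "(b, v) \<notin> (bichromatic E c r ?t)\<^sup>*"
      using linked_seen_nb[OF g bichromatic_rev _ rv(2) E(2) refl] n nC Fb dist by auto
    ultimately show False using star_three[OF f' rv] nc stF rv by metis
  qed
  obtain x y w where XX: "X = {x, y, w}" and d: "x \<noteq> y" "x \<noteq> w" "y \<noteq> w"
    using X(1) by (auto simp: card_3_iff)
  have G: "card (?F t \<inter> C) \<le> 2" if "t \<in> X" for t
  proof -
    have E: "{v, t} \<in> E" using X(3) that by auto
    then have "c {v, t} \<in> ?F t" "c {v, t} \<in> ?F v" using seenI seenI' by metis+
    then have "?F t \<inter> C \<subset> ?F t" by (auto simp: C_def)
    then have "card (?F t \<inter> C) < card (?F t)" using fin by (simp add: psubset_card_mono)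
    then show ?thesis using small_card[OF that, of c] by linarith
  qed
  have finC: "finite C" by (auto simp: C_def)
  \<comment> \<open>\<open>C\<close> has at least four colours and \<open>x\<close> sees at most two
    of them. The rest must be seen at both \<open>y\<close> and \<open>w\<close> and fills their
    quota of two, so \<open>y\<close> and \<open>w\<close> would miss the same remaining
    colours.\<close>
  have "card (C - ?F x \<inter> C) \<ge> 2"
    using diff_card_le_card_Diff[of "?F x \<inter> C" C] finC G[of x] XX cC D5 by auto
  moreover have "C - ?F x \<inter> C \<subseteq> ?F y \<inter> C" "C - ?F x \<inter> C \<subseteq> ?F w \<inter> C"
    using cover[of _ x y] cover[of _ x w] XX d by auto
  moreover have "card (?F y \<inter> C) \<le> 2" "card (?F w \<inter> C) \<le> 2" using G XX by auto
  moreover have "finite (?F y \<inter> C)" "finite (?F w \<inter> C)" using finC by auto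
  ultimately have "C - ?F x \<inter> C = ?F y \<inter> C" "C - ?F x \<inter> C = ?F w \<inter> C"
    by (meson card_seteq order.trans)+
  then have "?F y \<inter> C = ?F w \<inter> C" by simp
  then have "C \<subseteq> ?F y \<inter> C" using cover[of _ y w] XX d by auto
  then have "card C \<le> 2" using card_mono[of "?F y \<inter> C" C] finC G[of y] XX by auto
  then show False using cC D5 by linarith
qed

end

section \<open>Reducible configurations and discharging\<close>

definition neighbours :: "'a set set \<Rightarrow> 'a \<Rightarrow> 'a set" where
  "neighbours E v = {w. {v, w} \<in> E}"

lemma degree_neighbours:
  assumes "graph_edges E"
  shows "finite (neighbours E v)" "degree E v = card (neighbours E v)" "v \<notin> neighbours E v"
proof -
  have im: "{e \<in> E. v \<in> e} = (\<lambda>w. {v, w}) ` neighbours E v"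
  proof
    show "{e \<in> E. v \<in> e} \<subseteq> (\<lambda>w. {v, w}) ` neighbours E v"
    proof
      fix e assume e: "e \<in> {e \<in> E. v \<in> e}"
      obtain x y where xy: "e = {x, y}" using assms e unfolding graph_edges_def by blast
      then have "e = {v, if v = x then y else x}" using e by auto
      then show "e \<in> (\<lambda>w. {v, w}) ` neighbours E v" using e unfolding neighbours_def by blast
    qed
  qed (auto simp: neighbours_def)
  have inj: "inj_on (\<lambda>w. {v, w}) (neighbours E v)" by (auto simp: inj_on_def doubleton_eq_iff)
  have "finite {e \<in> E. v \<in> e}" using assms by (auto simp: graph_edges_def)
  then show "finite (neighbours E v)" unfolding im using inj by (rule finite_imageD)
  show "degree E v = card (neighbours E v)" unfolding degree_def im using inj by (rule card_image)
  show "v \<notin> neighbours E v" using assms by (auto simp: graph_edges_def neighbours_def)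
qed

lemma degree_mono: "graph_edges E \<Longrightarrow> E' \<subseteq> E \<Longrightarrow> degree E' x \<le> degree E x"
  unfolding degree_def graph_edges_def by (intro card_mono) auto

lemma degree_less:
  assumes "graph_edges E" "E' \<subseteq> E" "e \<in> E - E'" "x \<in> e"
  shows "degree E' x < degree E x"
  unfolding degree_def using assms by (intro psubset_card_mono) (auto simp: graph_edges_def)

lemma handshake:
  assumes "graph_edges E"
  shows "(\<Sum>v\<in>\<Union>E. degree E v) = 2 * card E"
proof -
  have fin: "finite E" "finite (\<Union>E)" using assms by (auto simp: graph_edges_def)
  have d: "degree E v = (\<Sum>e\<in>E. if v \<in> e then 1 else 0)" for v
    unfolding degree_def using fin by (simp add: sum.If_cases Int_def)
  have e: "(\<Sum>v\<in>\<Union>E. if v \<in> e then 1 else 0) = (2::nat)" if "e \<in> E" for e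
  proof -
    have "card e = 2" using assms that by (auto simp: graph_edges_def)
    moreover have "\<Union>E \<inter> {v. v \<in> e} = e" using that by auto
    ultimately show ?thesis using fin by (simp add: sum.If_cases)
  qed
  have "(\<Sum>v\<in>\<Union>E. degree E v) = (\<Sum>e\<in>E. \<Sum>v\<in>\<Union>E. if v \<in> e then 1 else 0)"
    unfolding d by (rule sum.swap)
  also have "\<dots> = (\<Sum>e\<in>E. 2)" by (intro sum.cong e refl)
  finally show ?thesis by simp
qed

text \<open>Discharging with initial charge \<open>3 deg v - 12\<close>: every vertex sends 3 to each neighbour of
  degree 2 and 1 to each neighbour of degree 3.\<close>

lemma discharging:
  assumes P: "graph_edges E"
    and n1: "\<And>u v. {u, v} \<in> E \<Longrightarrow> degree E u \<ge> 2"
    and n2: "\<And>u v. {u, v} \<in> E \<Longrightarrow> degree E u = 2 \<Longrightarrow> card {w \<in> neighbours E v. degree E w \<ge> 5} \<ge> 4"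
    and n3: "\<And>u v. {u, v} \<in> E \<Longrightarrow> degree E u = 3 \<Longrightarrow> degree E v \<ge> 5"
    and n5: "\<And>v. degree E v = 5 \<Longrightarrow> card {w \<in> neighbours E v. degree E w = 3} \<le> 3"
  shows "2 * card (\<Union>E) \<le> card E"
proof -
  let ?V = "\<Union>E" and ?d = "degree E"
  define h :: "'a \<Rightarrow> nat" where "h x = (if ?d x = 2 then 3 else if ?d x = 3 then 1 else 0)" for x
  have finV: "finite ?V" using P by (auto simp: graph_edges_def)
  have nbE: "{v, w} \<in> E" "{w, v} \<in> E" if "w \<in> neighbours E v" for v w
    using that by (auto simp: neighbours_def insert_commute)
  have finN: "finite (neighbours E v)" for v using degree_neighbours[OF P] by blast
  \<comment> \<open>Charge sent stands on the left and charge received on the right, to avoid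
    subtraction. Degrees 2 and 3 reach 12 as 6 + 2 * 3 and 9 + 3 * 1.\<close>
  have local: "12 + (\<Sum>w\<in>neighbours E v. h w) \<le> 3 * ?d v + ?d v * h v" if v: "v \<in> ?V" for v
  proof -
    let ?S = "{w \<in> neighbours E v. ?d w = 2}" and ?T = "{w \<in> neighbours E v. ?d w = 3}"
      and ?B = "{w \<in> neighbours E v. ?d w \<ge> 5}"
    have h: "(\<Sum>w\<in>neighbours E v. h w) = 3 * card ?S + card ?T"
    proof -
      have "(\<Sum>w\<in>neighbours E v. h w) = (\<Sum>w\<in>neighbours E v. (if ?d w = 2 then 3 else 0) + (if ?d w = 3 then 1 else 0))"
        by (intro sum.cong) (auto simp: h_def)
      then show ?thesis using finN by (simp add: sum.distrib sum.If_cases Int_def)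
    qed
    have d2: "?d v \<ge> 2"
    proof -
      obtain e where e: "e \<in> E" "v \<in> e" using v by auto
      then obtain x y where "e = {x, y}" using P unfolding graph_edges_def by blast
      then have "e = {v, if v = x then y else x}" using e by auto
      then show ?thesis using n1 e by metis
    qed
    have disj: "card ?S + card ?T + card ?B \<le> ?d v"
    proof -
      have "card ?S + card ?T + card ?B = card (?S \<union> ?T \<union> ?B)"
        using finN by (subst card_Un_disjoint, auto)+
      also have "\<dots> \<le> card (neighbours E v)" using finN by (intro card_mono) auto
      finally show ?thesis using degree_neighbours[OF P] by simp
    qed
    show ?thesis
    proof (cases "?S = {}")
      case False
      then obtain w where "w \<in> neighbours E v" "?d w = 2" by auto
      \<comment> \<open>Four neighbours receive nothing, so at most \<open>3 * (?d v - 4)\<close> is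
        sent, the initial charge.\<close>
      then have "card ?B \<ge> 4" using n2 nbE by blast
      then show ?thesis using disj h by linarith
    next
      case S: True
      show ?thesis
      proof (cases "?T = {}")
        case True
        then have "(\<Sum>w\<in>neighbours E v. h w) = 0" using h S by (simp only: card.empty)
        moreover have "?d v = 2 \<or> ?d v = 3 \<or> ?d v \<ge> 4" using d2 by linarith
        ultimately show ?thesis by (auto simp: h_def)
      next
        case False
        then obtain w where "w \<in> neighbours E v" "?d w = 3" by auto
        \<comment> \<open>A 5-vertex has charge 3, whence the bound on its 3-neighbours; from degree
          6 on, \<open>3 * ?d v - 12\<close> is at least \<open>?d v\<close>.\<close>
        then have "?d v \<ge> 5" using n3 nbE by blast
        moreover have "card ?T \<le> 3" if "?d v = 5" using n5 that by blast
        moreover have "card ?T \<le> ?d v" using disj by linarith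
        moreover have "card ?S = 0" using S by (simp only: card.empty)
        ultimately show ?thesis unfolding h by (cases "?d v = 5") auto
      qed
    qed
  qed
  have swap: "(\<Sum>v\<in>?V. \<Sum>w\<in>neighbours E v. h w) = (\<Sum>w\<in>?V. ?d w * h w)"
  proof -
    have nbV: "neighbours E v \<subseteq> ?V" for v using nbE by auto
    have "(\<Sum>v\<in>?V. \<Sum>w\<in>neighbours E v. h w) = (\<Sum>v\<in>?V. \<Sum>w\<in>?V. if {v, w} \<in> E then h w else 0)"
    proof (rule sum.cong[OF refl])
      fix v
      have "?V \<inter> {w. {v, w} \<in> E} = neighbours E v" using nbV[of v] by (auto simp: neighbours_def)
      then show "(\<Sum>w\<in>neighbours E v. h w) = (\<Sum>w\<in>?V. if {v, w} \<in> E then h w else 0)"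
        using finV by (simp add: sum.If_cases)
    qed
    also have "\<dots> = (\<Sum>w\<in>?V. \<Sum>v\<in>?V. if {v, w} \<in> E then h w else 0)" by (rule sum.swap)
    also have "\<dots> = (\<Sum>w\<in>?V. ?d w * h w)"
    proof (rule sum.cong[OF refl])
      fix w
      have "?V \<inter> {v. {v, w} \<in> E} = neighbours E w" using nbV[of w] by (auto simp: neighbours_def insert_commute)
      then show "(\<Sum>v\<in>?V. if {v, w} \<in> E then h w else 0) = ?d w * h w"
        using finV degree_neighbours[OF P, of w] by (simp add: sum.If_cases)
    qed
    finally show ?thesis .
  qed
  have "(\<Sum>v\<in>?V. 12 + (\<Sum>w\<in>neighbours E v. h w)) \<le> (\<Sum>v\<in>?V. 3 * ?d v + ?d v * h v)"
    by (intro sum_mono local)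
  then have "12 * card ?V \<le> 3 * (\<Sum>v\<in>?V. ?d v)"
    unfolding sum.distrib swap by (simp add: sum_distrib_left)
  then show ?thesis using handshake[OF P] by linarith
qed

section \<open>Reducible configurations in an edge-minimal counterexample\<close>

locale minimal_graph =
  fixes E :: "'a set set" and D :: nat
  assumes P: "graph_edges E" and deg: "\<And>x. degree E x \<le> D"
    and minimal: "\<And>E'. E' \<subset> E \<Longrightarrow> \<exists>c. acyclic_coloring E' (D + 3) c"
    and uncolored: "\<nexists>c. acyclic_coloring E (D + 3) c"
begin

lemma edge_ne: "{x, y} \<in> E \<Longrightarrow> x \<noteq> y"
  using P unfolding graph_edges_def by fastforce

lemma edge_degree: "{u, v} \<in> E \<Longrightarrow> degree E u \<ge> 1"
  using degree_neighbours[OF P, of u] by (metis One_nat_def Suc_leI card_gt_0_iff empty_iff mem_Collect_eq neighbours_def)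

lemma no_leaf:
  assumes uv: "{u, v} \<in> E"
  shows "degree E u \<ge> 2"
proof (rule ccontr)
  assume "\<not> ?thesis"
  then have "card (neighbours E u) = 1" using edge_degree[OF uv] degree_neighbours[OF P] by simp
  moreover have "v \<in> neighbours E u" using uv by (simp add: neighbours_def)
  ultimately have N: "neighbours E u = {v}" by (metis card_1_singletonE singletonD)
  let ?E = "E - {{u, v}}"
  have "?E \<subset> E" using uv by auto
  then obtain c where g: "acyclic_coloring ?E (D + 3) c" using minimal by blast
  have P': "graph_edges ?E" using P graph_edges_subset by blast
  have su: "seen ?E c u = {}"
  proof (rule ccontr)
    assume "seen ?E c u \<noteq> {}"
    then obtain q where "q \<in> seen ?E c u" by auto
    then obtain y where "{u, y} \<in> ?E" using seenE[OF P'] by metis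
    then show False using N by (auto simp: neighbours_def)
  qed
  have "card (seen ?E c v) < D + 3"
    using card_seen[OF P', of c v] degree_mono[OF P, of ?E v] deg[of v] by force
  then obtain r where r: "r < D + 3" "r \<notin> seen ?E c v"
    using pick_color finite_seen[OF P'] by blast
  have "acyclic_coloring (insert {u, v} ?E) (D + 3) (c({u, v} := r))"
    using edge_ne[OF uv] r su by (intro acyclic_coloring_insert_seen[OF g]) auto
  moreover have "insert {u, v} ?E = E" using uv by auto
  ultimately show False using uncolored by auto
qed

lemma star_edges: "E = (\<lambda>w. {u, w}) ` neighbours E u \<union> {e \<in> E. u \<notin> e}"
proof (intro equalityI subsetI)
  fix e assume e: "e \<in> E"
  show "e \<in> (\<lambda>w. {u, w}) ` neighbours E u \<union> {e \<in> E. u \<notin> e}"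
  proof (cases "u \<in> e")
    case True
    obtain x y where "e = {x, y}" using P e unfolding graph_edges_def by metis
    then have "e = {u, if u = x then y else x}" using True by auto
    then obtain w where w: "e = {u, w}" by blast
    then have "w \<in> neighbours E u" using e by (simp add: neighbours_def)
    then show ?thesis unfolding w by (intro UnI1 imageI)
  qed (use e in simp)
qed (auto simp: neighbours_def)

text \<open>The colour of \<open>ua\<close> avoids the at most \<open>D - 1\<close> colours at
  \<open>a\<close> and those of the at most three edges from \<open>v\<close> to neighbours of
  degree at least 5. If it still occurs at \<open>v\<close>, it leads to some \<open>x\<close> of
  degree at most 4, and \<open>uv\<close> has to avoid at most \<open>D - 1\<close> colours at
  \<open>v\<close> and three more at \<open>x\<close>.\<close>

lemma two_vertex:
  assumes uv: "{u, v} \<in> E" and d: "degree E u = 2"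
  shows "card {w \<in> neighbours E v. degree E w \<ge> 5} \<ge> 4"
proof (rule ccontr)
  assume "\<not> ?thesis"
  then have B3: "card {w \<in> neighbours E v. degree E w \<ge> 5} \<le> 3" by simp
  have "card (neighbours E u) = 2" using d degree_neighbours[OF P] by simp
  moreover have "v \<in> neighbours E u" using uv by (simp add: neighbours_def)
  ultimately obtain a where a: "neighbours E u = {v, a}" "a \<noteq> v"
    by (metis card_2_iff insertE insert_commute singletonD)
  have uu: "u \<noteq> v" "u \<noteq> a" using a degree_neighbours(3)[OF P, of u] by auto
  have ua: "{u, a} \<in> E" using a by (auto simp: neighbours_def)
  let ?E = "{e \<in> E. u \<notin> e}"
  have E: "E = insert {u, v} (insert {u, a} ?E)" using star_edges[of u] a by auto
  have P': "graph_edges ?E" using P by (rule graph_edges_subset) auto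
  have "?E \<subset> E" using uv by auto
  then obtain c where g: "acyclic_coloring ?E (D + 3) c" using minimal by blast
  have Dpos: "D \<ge> 2" using deg[of u] d by simp
  have sv: "card (seen ?E c v) \<le> D - 1"
    using card_seen[OF P', of c v] degree_less[OF P, of ?E "{u, v}" v] uv deg[of v] by force
  have sa: "card (seen ?E c a) \<le> D - 1"
    using card_seen[OF P', of c a] degree_less[OF P, of ?E "{u, a}" a] ua deg[of a] by force
  have su: "seen ?E c u = {}" by (auto simp: seen_def)
  note fin' = finite_seen[OF P', of c]
  let ?B = "(\<lambda>w. c {v, w}) ` {w \<in> neighbours E v. degree E w \<ge> 5}"
  have finB: "finite {w \<in> neighbours E v. degree E w \<ge> 5}" using degree_neighbours[OF P] by simp
  have "card ?B \<le> 3" using card_image_le[OF finB] B3 by (rule order.trans)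
  then have "card (seen ?E c a \<union> ?B) < D + 3"
    using card_Un_le[of "seen ?E c a" ?B] sa Dpos by linarith
  moreover have "finite (seen ?E c a \<union> ?B)" using fin' finB by blast
  ultimately obtain p where p: "p < D + 3" "p \<notin> seen ?E c a \<union> ?B" by (rule pick_color)
  have uaE: "{u, a} \<notin> ?E" by auto
  let ?E1 = "insert {u, a} ?E" and ?c = "c({u, a} := p)"
  have g1: "acyclic_coloring ?E1 (D + 3) ?c"
    using uu p su by (intro acyclic_coloring_insert_seen[OF g _ uaE]) auto
  have uvE: "{u, v} \<notin> ?E1" using a uu by (auto simp: doubleton_eq_iff)
  have s1: "seen ?E1 ?c w = (if w = u then {p} else if w = a then insert p (seen ?E c a) else seen ?E c w)" for w
    unfolding seen_insert[OF uaE] using su uu by auto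
  have fin: False if r: "r < D + 3" "r \<noteq> p" "r \<notin> seen ?E c v"
    and nx: "\<And>x. {v, x} \<in> ?E \<Longrightarrow> c {v, x} = p \<Longrightarrow> r \<notin> seen ?E c x" for r
  proof -
    have "acyclic_coloring (insert {u, v} ?E1) (D + 3) (?c({u, v} := r))"
    proof (rule acyclic_coloring_insert_seen[OF g1 uu(1) uvE r(1)])
      fix w assume w: "{v, w} \<in> ?E1" "?c {v, w} \<in> seen ?E1 ?c u"
      have "{v, w} \<noteq> {u, a}" using a uu by (auto simp: doubleton_eq_iff)
      then have w': "{v, w} \<in> ?E" "c {v, w} = p" using w unfolding s1 by auto
      then have "w \<noteq> u" by auto
      moreover have "w \<noteq> a" using w' p seenI'[OF w'(1), of c] by auto
      ultimately show "r \<notin> seen ?E1 ?c w" using nx[OF w'] unfolding s1 by simp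
    qed (use r uu a in \<open>auto simp: s1\<close>)
    then show False using uncolored E by metis
  qed
  show False
  proof (cases "p \<in> seen ?E c v")
    case False
    have "card (insert p (seen ?E c v)) < D + 3"
      using sv Dpos card_insert_le_m1[of "D + 2" "seen ?E c v" p] by linarith
    moreover have "finite (insert p (seen ?E c v))" using fin' by (rule finite.insertI)
    ultimately obtain r where r: "r < D + 3" "r \<notin> insert p (seen ?E c v)" by (rule pick_color)
    have "c {v, x} \<noteq> p" if "{v, x} \<in> ?E" for x using seenI[OF that, of c] False by auto
    then show False using fin[of r] r by blast
  next
    case True
    then obtain x where x: "{v, x} \<in> ?E" "c {v, x} = p" "x \<noteq> v" by (rule seenE[OF P'])
    have "x \<in> neighbours E v" using x by (simp add: neighbours_def)
    then have "degree E x < 5" using x p by (auto simp: not_le[symmetric])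
    then have "card (seen ?E c x) \<le> 4"
      using card_seen[OF P', of c x] degree_mono[OF P, of ?E x] by force
    moreover have "p \<in> seen ?E c x" using seenI'[OF x(1), of c] x(2) by simp
    ultimately have "card (seen ?E c x - {p}) \<le> 3" by (simp add: card_Diff_singleton)
    then have "card (seen ?E c v \<union> (seen ?E c x - {p})) < D + 3"
      using card_Un_le[of "seen ?E c v" "seen ?E c x - {p}"] sv Dpos by linarith
    moreover have "finite (seen ?E c v \<union> (seen ?E c x - {p}))" using fin' by blast
    ultimately obtain r where r: "r < D + 3" "r \<notin> seen ?E c v \<union> (seen ?E c x - {p})"
      by (rule pick_color)
    have "r \<noteq> p" using r True by auto
    moreover have "y = x" if "{v, y} \<in> ?E" "c {v, y} = p" for y
      using acyclic_coloring_unique[OF g that(1) x(1)] that(2) x(2) by simp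
    ultimately show False using fin[of r] r by blast
  qed
qed

text \<open>The fork is read off a colouring of the graph without the edge \<open>uv\<close>: a path
  from \<open>a\<close> to \<open>b\<close> in the colours of \<open>ua\<close> and
  \<open>ub\<close> would close up through \<open>u\<close>.\<close>

lemma three_vertex_star:
  assumes uv: "{u, v} \<in> E" and d: "degree E u = 3"
  obtains a b c p q where
    "star {e \<in> E. u \<notin> e} (D + 3) D u a b v"
    "E = insert {u, v} (insert {u, a} (insert {u, b} {e \<in> E. u \<notin> e}))"
    "fork {e \<in> E. u \<notin> e} (D + 3) a b c p q"
proof -
  have c3: "card (neighbours E u) = 3" using d degree_neighbours[OF P] by simp
  have vN: "v \<in> neighbours E u" using uv by (simp add: neighbours_def)
  have "card (neighbours E u - {v}) = 2" using c3 vN by (simp add: card_Diff_singleton)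
  then obtain a b where "neighbours E u - {v} = {a, b}" and ab: "a \<noteq> b" by (auto simp: card_2_iff)
  then have N: "neighbours E u = {v, a, b}" "a \<noteq> v" "b \<noteq> v" using vN by auto
  have uu: "u \<noteq> v" "u \<noteq> a" "u \<noteq> b" using N degree_neighbours(3)[OF P, of u] by auto
  let ?E = "{e \<in> E. u \<notin> e}"
  have E: "E = insert {u, v} (insert {u, a} (insert {u, b} ?E))" using star_edges[of u] N by auto
  have eE: "{u, a} \<in> E" "{u, b} \<in> E" using N by (auto simp: neighbours_def)
  have P': "graph_edges ?E" using P by (rule graph_edges_subset) auto
  have st: "star ?E (D + 3) D u a b v"
  proof
    show "degree ?E x \<le> D" for x using degree_mono[OF P, of ?E x] deg[of x] by force
    show "degree ?E a < D" using degree_less[OF P, of ?E "{u, a}" a] eE deg[of a] by force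
    show "degree ?E b < D" using degree_less[OF P, of ?E "{u, b}" b] eE deg[of b] by force
    show "D \<ge> 3" using deg[of u] d by simp
  qed (use P' uu N ab in auto)
  let ?H = "insert {u, a} (insert {u, b} ?E)"
  have "{u, v} \<notin> ?H" using N uu by (auto simp: doubleton_eq_iff)
  moreover have "?H \<subseteq> E" using eE by auto
  ultimately have "?H \<subset> E" using uv by (metis psubsetI)
  from minimal[OF this] obtain c where g: "acyclic_coloring ?H (D + 3) c" by (rule exE)
  let ?p = "c {u, a}" and ?q = "c {u, b}"
  have pq: "?p \<noteq> ?q" using acyclic_coloring_unique[OF g, of u a b] ab by auto
  have g1: "acyclic_coloring ?E (D + 3) c" using g by (rule acyclic_coloring_subset) auto
  have sub: "seen ?E c x \<subseteq> seen (?H - {{u, y}}) c x" for x y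
    by (intro seen_mono subsetI DiffI insertI2) auto
  have "?p \<notin> seen ?E c a" using sub[of a a] seen_remove[OF g, of u a a] by auto
  moreover have "?q \<notin> seen ?E c b" using sub[of b b] seen_remove[OF g, of u b b] by auto
  moreover have "(a, b) \<notin> (bichromatic ?E c ?p ?q)\<^sup>*"
  proof
    assume "(a, b) \<in> (bichromatic ?E c ?p ?q)\<^sup>*"
    moreover have "bichromatic ?E c ?p ?q \<subseteq> bichromatic (?H - {{u, a}}) c ?p ?q"
      by (intro bichromatic_mono subsetI DiffI insertI2) auto
    ultimately have "(a, b) \<in> (bichromatic (?H - {{u, a}}) c ?p ?q)\<^sup>*" by (meson rtrancl_mono subsetD)
    moreover have "(b, u) \<in> bichromatic (?H - {{u, a}}) c ?p ?q"
      using ab by (auto simp: bichromatic_def insert_commute doubleton_eq_iff)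
    ultimately have "(a, u) \<in> (bichromatic (?H - {{u, a}}) c ?p ?q)\<^sup>*"
      by (rule rtrancl.rtrancl_into_rtrancl)
    then have "(u, a) \<in> (bichromatic (?H - {{u, a}}) c ?p ?q)\<^sup>*" by (rule bichromatic_rev)
    then show False using acyclic_coloringD_unlinked[OF g, of u a] by simp
  qed
  ultimately have "fork ?E (D + 3) a b c ?p ?q"
    unfolding fork_def using g1 pq acyclic_coloringD_less[OF g] by auto
  then show thesis using that st E by blast
qed

lemma three_vertex:
  assumes uv: "{u, v} \<in> E" and d: "degree E u = 3"
  shows "degree E v \<ge> 5"
proof (rule ccontr)
  assume dv: "\<not> ?thesis"
  obtain a b c p q where st: "star {e \<in> E. u \<notin> e} (D + 3) D u a b v"
    and E: "E = insert {u, v} (insert {u, a} (insert {u, b} {e \<in> E. u \<notin> e}))"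
    and f: "fork {e \<in> E. u \<notin> e} (D + 3) a b c p q"
    using three_vertex_star[OF uv d] by blast
  have "degree {e \<in> E. u \<notin> e} v \<le> 3"
    using degree_less[OF P, of "{e \<in> E. u \<notin> e}" "{u, v}" v] uv dv by force
  then have "star3 {e \<in> E. u \<notin> e} (D + 3) D u a b v"
    using st by (simp add: star3_def star3_axioms_def)
  then have "completable {e \<in> E. u \<notin> e} (D + 3) u a b v" using f by (rule star3.complete)
  then show False using uncolored E unfolding completable_def by metis
qed

lemma five_vertex:
  assumes dv: "degree E v = 5"
  shows "card {w \<in> neighbours E v. degree E w = 3} \<le> 3"
proof (rule ccontr)
  let ?T = "{w \<in> neighbours E v. degree E w = 3}"
  assume "\<not> ?thesis"
  then have T: "card ?T \<ge> 4" by simp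
  then obtain u where u: "u \<in> ?T" by (metis card.empty ex_in_conv not_numeral_le_zero)
  have uv: "{u, v} \<in> E" "degree E u = 3" using u by (auto simp: neighbours_def insert_commute)
  obtain a b c p q where st: "star {e \<in> E. u \<notin> e} (D + 3) D u a b v"
    and E: "E = insert {u, v} (insert {u, a} (insert {u, b} {e \<in> E. u \<notin> e}))"
    and f: "fork {e \<in> E. u \<notin> e} (D + 3) a b c p q"
    using three_vertex_star[OF uv] by blast
  have "card (?T - {u}) \<ge> 3" using T u by (simp add: card_Diff_singleton)
  \<comment> \<open>\<open>u\<close> and \<open>X\<close> are four neighbours of degree 3; the fifth
    neighbour \<open>z\<close> may have any degree.\<close>
  then obtain X where X: "X \<subseteq> ?T - {u}" "card X = 3" by (meson obtain_subset_with_card_n)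
  have finX: "finite X" using X by (metis card.infinite zero_neq_numeral)
  have uN: "u \<in> neighbours E v" using u by simp
  have "card (neighbours E v - {u}) = 4" using dv degree_neighbours[OF P, of v] uN by (simp add: card_Diff_singleton)
  then have "card (neighbours E v - {u} - X) = 1" using X finX by (subst card_Diff_subset) auto
  then obtain z where z: "neighbours E v - {u} - X = {z}" by (meson card_1_singletonE)
  have vu: "v \<noteq> u" using edge_ne[OF uv(1)] by auto
  have "star5 {e \<in> E. u \<notin> e} (D + 3) D u a b v X z"
  proof (intro star5.intro star5_axioms.intro st)
    show "card X = 3" "z \<notin> X" "D \<ge> 5" using X z deg[of v] dv by auto
    show "{v, w} \<in> {e \<in> E. u \<notin> e} \<longleftrightarrow> w \<in> insert z X" for w
    proof -
      have "insert z X = neighbours E v - {u}" using z X by auto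
      then show ?thesis using vu by (auto simp: neighbours_def)
    qed
    fix x assume "x \<in> X"
    then have "degree E x = 3" using X by auto
    moreover have "insert {u, a} (insert {u, b} {e \<in> E. u \<notin> e}) \<subseteq> E"
      using subset_insertI[of "insert {u, a} (insert {u, b} {e \<in> E. u \<notin> e})" "{u, v}"]
      unfolding E[symmetric] .
    ultimately show "degree (insert {u, a} (insert {u, b} {e \<in> E. u \<notin> e})) x \<le> 3"
      using degree_mono[OF P] by metis
  qed
  then have "completable {e \<in> E. u \<notin> e} (D + 3) u a b v" using f by (rule star5.complete)
  then show False using uncolored E unfolding completable_def by metis
qed

lemma dense: "2 * card (\<Union>E) \<le> card E"
  using P no_leaf two_vertex three_vertex five_vertex by (rule discharging)

end

section \<open>Sparse graphs and the final bound\<close>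

text \<open>Both the degree bound \<open>D\<close> and the sparsity condition pass to subsets of the
  edges with the number of colours unchanged. A minimal counterexample is too dense on the set of
  vertices covered by its edges.\<close>

lemma sparse_acyclic_coloring:
  assumes "graph_edges E" "\<And>x. degree E x \<le> D"
    and "\<And>S. finite S \<Longrightarrow> S \<noteq> {} \<Longrightarrow> card {e \<in> E. e \<subseteq> S} < 2 * card S"
  shows "\<exists>c. acyclic_coloring E (D + 3) c"
proof -
  have "finite E" using assms(1) by (simp add: graph_edges_def)
  then show ?thesis using assms
  proof (induction E rule: finite_psubset_induct)
    case (psubset E)
    note P = psubset.prems(1) and deg = psubset.prems(2) and sparse = psubset.prems(3)
    show ?case
    proof (rule ccontr)
      assume n: "\<not> ?case"
      have "minimal_graph E D"
      proof
        fix E' assume E': "E' \<subset> E"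
        show "\<exists>c. acyclic_coloring E' (D + 3) c"
        proof (rule psubset.IH[OF E'])
          show "graph_edges E'" using P E' graph_edges_subset by blast
          show "degree E' x \<le> D" for x using degree_mono[OF P, of E' x] E' deg[of x] by force
          fix S :: "'a set" assume S: "finite S" "S \<noteq> {}"
          have "card {e \<in> E'. e \<subseteq> S} \<le> card {e \<in> E. e \<subseteq> S}"
            using E' psubset.hyps by (intro card_mono) auto
          then show "card {e \<in> E'. e \<subseteq> S} < 2 * card S" using sparse[OF S] by linarith
        qed
      qed (use P deg n in auto)
      then have dense: "2 * card (\<Union>E) \<le> card E" by (rule minimal_graph.dense)
      have "E \<noteq> {}"
      proof
        assume "E = {}"
        then have "acyclic_coloring E (D + 3) (\<lambda>_. 0)" by (simp add: acyclic_coloring_def proper_edge_coloring_def)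
        then show False using n by blast
      qed
      then have "\<Union>E \<noteq> {}" "finite (\<Union>E)" using P unfolding graph_edges_def by fastforce+
      moreover have "{e \<in> E. e \<subseteq> \<Union>E} = E" by auto
      ultimately show False using sparse[of "\<Union>E"] dense by simp
    qed
  qed
qed

theorem theorem1:
  fixes V :: "'a set" and E :: "'a set set"
  assumes "simple_graph V E"
    and "\<forall>S. S \<subseteq> V \<and> S \<noteq> {} \<longrightarrow> card (induced_edges E S) \<le> 2 * card S - 1"
  shows "acyclic_chromatic_index V E \<le> max_degree V E + 3"
proof -
  let ?D = "max_degree V E"
  have V: "finite V" and e: "\<And>e. e \<in> E \<Longrightarrow> \<exists>u v. u \<in> V \<and> v \<in> V \<and> u \<noteq> v \<and> e = {u, v}"
    using assms(1) by (auto simp: simple_graph_def)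
  have EV: "f \<subseteq> V" if "f \<in> E" for f using e[OF that] by auto
  then have "E \<subseteq> Pow V" by blast
  then have finE: "finite E" using V by (meson finite_Pow_iff finite_subset)
  have P: "graph_edges E" unfolding graph_edges_def using finE e by blast
  have deg: "degree E x \<le> ?D" for x
  proof (cases "x \<in> V")
    case True
    then show ?thesis using V by (auto simp: max_degree_def)
  next
    case False
    then have "{f \<in> E. x \<in> f} = {}" using EV by blast
    then show ?thesis unfolding degree_def by (simp only: card.empty le0)
  qed
  \<comment> \<open>Vertices outside \<open>V\<close> lie on no edge, so \<open>S\<close> may be cut
    down to its part in \<open>V\<close>; if that is nonempty, the truncated subtraction is
    exact.\<close>
  have sparse: "card {f \<in> E. f \<subseteq> S} < 2 * card S" if S: "finite S" "S \<noteq> {}" for S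
  proof (cases "S \<inter> V = {}")
    case True
    then have "{f \<in> E. f \<subseteq> S} = {}" using e by fastforce
    then have "card {f \<in> E. f \<subseteq> S} = 0" by (simp only: card.empty)
    moreover have "card S > 0" using S by (simp add: card_gt_0_iff)
    ultimately show ?thesis by linarith
  next
    case False
    have "card (induced_edges E (S \<inter> V)) \<le> 2 * card (S \<inter> V) - 1" using assms(2) False by blast
    moreover have "induced_edges E (S \<inter> V) = {f \<in> E. f \<subseteq> S}"
      using EV by (auto simp: induced_edges_def)
    moreover have "card (S \<inter> V) \<le> card S" using S by (intro card_mono) auto
    moreover have "card (S \<inter> V) > 0" using S False by (simp add: card_gt_0_iff)
    ultimately show ?thesis by simp
  qed
  obtain c where "acyclic_coloring E (?D + 3) c" using sparse_acyclic_coloring[OF P deg sparse] by blast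
  then have "acyclic_edge_coloring E (?D + 3) c" by (rule forest_imp_acyclic_edge_coloring)
  then show ?thesis unfolding acyclic_chromatic_index_def by (blast intro: Least_le)
qed

end
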